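(* Let $\mathcal{A}$ be a unital C*-algebra and let $a\in\mathcal{A}^+$. Then the following conditions are equivalent: (i) $a$ is invertible; (ii) for every $\alpha\in\mathbb{R}$, $\|\cdot\|_{a^\alpha}$ is equivalent to $\|\cdot\|$ on $\mathcal{A}^*_{\mathrm{h}}$ (for $\alpha<0$ this includes the requirement that the power $a^\alpha$ be defined in $\mathcal{A}$); (iii) for every $\alpha\in\mathbb{R}^+$, $\|\cdot\|_{a^\alpha}$ is equivalent to $\|\cdot\|$ on $\mathcal{A}^*_{\mathrm{h}}$; (iv) $\varphi(a)>0$ for every $\varphi\in\mathcal{A}^*_+\setminus\{0\}$, and there exist $\alpha,\beta\in\mathbb{R}^+$ with $\alpha\neq\beta$ such that $\|\cdot\|_{a^\alpha}$ is equivalent to $\|\cdot\|_{a^\beta}$ on $\mathcal{A}^*_{\mathrm{h}}$.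
   Context: $\mathcal{A}^+$ is the cone of positive elements of the C*-algebra $\mathcal{A}$; $\mathcal{A}^*$ is the Banach dual of $\mathcal{A}$, $\mathcal{A}^*_{\mathrm{h}}$ the real space of Hermitian continuous linear functionals, $\mathcal{A}^*_+$ the cone of positive continuous linear functionals. $\|\cdot\|$ is the usual dual norm on $\mathcal{A}^*_{\mathrm{h}}$. For $b\in\mathcal{A}^+$ the seminorm $r_b$ on $\mathcal{A}^*_{\mathrm{h}}$ is $$r_b(f)=\inf\{f_1(b)+f_2(b)\ :\ f=f_1-f_2,\ f_1,f_2\in\mathcal{A}^*_+\}.$$ When $r_b$ is faithful (i.e. is a norm on $\mathcal{A}^*_{\mathrm{h}}$), it is denoted $\|\cdot\|_b$; an assertion involving $\|\cdot\|_b$ includes the assertion that $r_b$ is a norm. Two norms $p,q$ are equivalent if there are constants $c,C>0$ with $c\,p\le q\le C\,p$. Powers $a^\alpha$ are taken by continuous functional calculus, with $a^0=\mathbf{1}$; for $\alpha<0$ the power $a^\alpha$ is defined only when $a$ is invertible. $\mathbb{R}^+=(0,\infty)$. *)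

theory Defs
  imports "HOL-Analysis.Bounded_Linear_Function" "HOL-Library.Nonpos_Ints"
begin

text \<open>
  Unital C*-algebras. As usual the unital algebra is nonzero with \<open>norm 1 = 1\<close>
  (both from \<^class>\<open>real_normed_algebra_1\<close>), and the real structure of
  the library classes is the restriction of the complex one.
\<close>

class cstar_algebra = real_normed_algebra_1 + banach +
  fixes scaleC :: "complex \<Rightarrow> 'a \<Rightarrow> 'a" (infixr "*\<^sub>C" 75)
    and star :: "'a \<Rightarrow> 'a"
  assumes scaleR_scaleC: "scaleR r x = complex_of_real r *\<^sub>C x"
    and scaleC_add_right: "c *\<^sub>C (x + y) = c *\<^sub>C x + c *\<^sub>C y"
    and scaleC_add_left: "(c + d) *\<^sub>C x = c *\<^sub>C x + d *\<^sub>C x"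
    and scaleC_scaleC: "c *\<^sub>C (d *\<^sub>C x) = (c * d) *\<^sub>C x"
    and scaleC_one: "1 *\<^sub>C x = x"
    and mult_scaleC_left: "(c *\<^sub>C x) * y = c *\<^sub>C (x * y)"
    and mult_scaleC_right: "x * (c *\<^sub>C y) = c *\<^sub>C (x * y)"
    and norm_scaleC: "norm (c *\<^sub>C x) = cmod c * norm x"
    and star_star: "star (star x) = x"
    and star_add: "star (x + y) = star x + star y"
    and star_scaleC: "star (c *\<^sub>C x) = cnj c *\<^sub>C star x"
    and star_mult: "star (x * y) = star y * star x"
    and cstar_identity: "norm (star x * x) = (norm x)\<^sup>2"

definition invertible_elem :: "'a::cstar_algebra \<Rightarrow> bool" where
  "invertible_elem a \<longleftrightarrow> (\<exists>b. a * b = 1 \<and> b * a = 1)"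

definition spectrum :: "'a::cstar_algebra \<Rightarrow> complex set" where
  "spectrum a = {z. \<not> invertible_elem (a - z *\<^sub>C 1)}"

definition positive_cone :: "'a::cstar_algebra set" where
  "positive_cone = {a. star a = a \<and> spectrum a \<subseteq> \<real>\<^sub>\<ge>\<^sub>0}"

text \<open>
  The continuous functional calculus at \<open>a\<close> is the isometric unital
  *-homomorphism from the continuous functions on the spectrum into the algebra
  that sends the identity function to \<open>a\<close>. Continuous functions on the spectrum
  are represented by functions on the whole plane that are continuous on the
  spectrum; by linearity and isometry the value depends only on the restriction
  to the spectrum. For normal \<open>a\<close> such a map exists and its values on these
  functions are unique, so the choice operator is harmless.
\<close>

definition is_functional_calculus ::
    "'a::cstar_algebra \<Rightarrow> ((complex \<Rightarrow> complex) \<Rightarrow> 'a) \<Rightarrow> bool" where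
  "is_functional_calculus a \<Phi> \<longleftrightarrow>
     \<Phi> (\<lambda>z. 1) = 1 \<and> \<Phi> (\<lambda>z. z) = a \<and>
     (\<forall>f. continuous_on (spectrum a) f \<longrightarrow>
        (\<forall>c. \<Phi> (\<lambda>z. c * f z) = c *\<^sub>C \<Phi> f) \<and>
        \<Phi> (\<lambda>z. cnj (f z)) = star (\<Phi> f) \<and>
        norm (\<Phi> f) = (SUP z\<in>spectrum a. cmod (f z))) \<and>
     (\<forall>f g. continuous_on (spectrum a) f \<longrightarrow> continuous_on (spectrum a) g \<longrightarrow>
        \<Phi> (\<lambda>z. f z + g z) = \<Phi> f + \<Phi> g \<and>
        \<Phi> (\<lambda>z. f z * g z) = \<Phi> f * \<Phi> g)"

definition cfc :: "'a::cstar_algebra \<Rightarrow> (complex \<Rightarrow> complex) \<Rightarrow> 'a" where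
  "cfc a = (SOME \<Phi>. is_functional_calculus a \<Phi>)"

text \<open>
  Real powers of a positive element. The exponent 0 is separated because
  \<open>0 powr 0 = 0\<close>, whereas the zeroth power is the unit. For a negative exponent
  \<open>cstar_power a \<alpha>\<close> is meaningful only under \<open>power_defined a \<alpha>\<close>.
\<close>

definition cstar_power :: "'a::cstar_algebra \<Rightarrow> real \<Rightarrow> 'a" where
  "cstar_power a \<alpha> =
     (if \<alpha> = 0 then 1 else cfc a (\<lambda>z. complex_of_real (Re z powr \<alpha>)))"

definition power_defined :: "'a::cstar_algebra \<Rightarrow> real \<Rightarrow> bool" where
  "power_defined a \<alpha> \<longleftrightarrow> (\<alpha> < 0 \<longrightarrow> invertible_elem a)"

text \<open>
  The type \<open>'a \<Rightarrow>\<^sub>L complex\<close> consists of the bounded real-linear maps; the dual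
  is cut out by complex homogeneity, and the norm of the type is the dual norm.
\<close>

definition dual :: "('a::cstar_algebra \<Rightarrow>\<^sub>L complex) set" where
  "dual = {f. \<forall>c x. blinfun_apply f (c *\<^sub>C x) = c * blinfun_apply f x}"

definition dual_herm :: "('a::cstar_algebra \<Rightarrow>\<^sub>L complex) set" where
  "dual_herm = {f \<in> dual. \<forall>x. blinfun_apply f (star x) = cnj (blinfun_apply f x)}"

definition dual_pos :: "('a::cstar_algebra \<Rightarrow>\<^sub>L complex) set" where
  "dual_pos = {f \<in> dual. \<forall>x\<in>positive_cone. blinfun_apply f x \<in> \<real>\<^sub>\<ge>\<^sub>0}"

text \<open>
  Used for \<open>b\<close> in the positive cone, where positive functionals take real
  values, so taking \<^const>\<open>Re\<close> only changes the type.
\<close>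

definition r_seminorm :: "'a::cstar_algebra \<Rightarrow> ('a \<Rightarrow>\<^sub>L complex) \<Rightarrow> real" where
  "r_seminorm b f =
     Inf {Re (blinfun_apply f1 b) + Re (blinfun_apply f2 b) | f1 f2.
            f1 \<in> dual_pos \<and> f2 \<in> dual_pos \<and> f = f1 - f2}"

definition norm_on :: "'v::real_vector set \<Rightarrow> ('v \<Rightarrow> real) \<Rightarrow> bool" where
  "norm_on S p \<longleftrightarrow>
     (\<forall>x\<in>S. 0 \<le> p x \<and> (p x = 0 \<longleftrightarrow> x = 0)) \<and>
     (\<forall>c. \<forall>x\<in>S. p (c *\<^sub>R x) = \<bar>c\<bar> * p x) \<and>
     (\<forall>x\<in>S. \<forall>y\<in>S. p (x + y) \<le> p x + p y)"

text \<open>Includes the assertion that both functions are norms on \<open>S\<close>.\<close>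

definition equivalent_norms_on ::
    "'v::real_vector set \<Rightarrow> ('v \<Rightarrow> real) \<Rightarrow> ('v \<Rightarrow> real) \<Rightarrow> bool" where
  "equivalent_norms_on S p q \<longleftrightarrow>
     norm_on S p \<and> norm_on S q \<and>
     (\<exists>c>0. \<exists>C>0. \<forall>x\<in>S. c * p x \<le> q x \<and> q x \<le> C * p x)"

end

theory Submission
  imports Defs "HOL-Analysis.Weierstrass_Theorems"
    "HOL-Computational_Algebra.Fundamental_Theorem_Algebra"
begin

text \<open>
  The proof compares everything with the unit. On the self-adjoint part of a C*-algebra the norm is
  the order-unit norm of \<open>1\<close>: for self-adjoint \<open>x\<close>, \<open>norm x \<le> t\<close> holds iff \<open>- t \<le> x \<le> t\<close>, where
  \<open>\<le>\<close> is the order of the positive cone (\<open>norm_minus_selfadjoint_positive\<close>,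
  \<open>norm_le_of_positive\<close>). Dually, every Hermitian \<open>f\<close> is a difference \<open>f1 - f2\<close> of positive
  functionals with \<open>f1 1 + f2 1 \<le> norm f\<close> (\<open>positive_decomposition\<close>), and a positive functional
  satisfies \<open>norm f \<le> f 1\<close> (\<open>norm_dual_pos_le\<close>); hence the seminorm of \<open>b = 1\<close> is the dual norm.

  If \<open>a\<close> is invertible, its spectrum is a compact subset of the open half-line, so each power
  satisfies \<open>c \<le> a\<^sup>\<alpha> \<le> d\<close> with \<open>c > 0\<close> (\<open>cstar_power_bounds\<close>). Positive functionals preserve this, so
  the seminorm of \<open>a\<^sup>\<alpha>\<close> lies between \<open>c\<close> and \<open>d\<close> times the dual norm
  (\<open>r_seminorm_equivalent_norm\<close>). All powers thus give norms equivalent to the dual norm, and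
  \<open>\<phi> a \<ge> c \<sqdot> norm \<phi>\<close> for positive \<open>\<phi>\<close>.

  If \<open>a\<close> is not invertible, then \<open>0\<close> is in its spectrum and \<open>t \<sqdot> 1 + s \<sqdot> a \<ge> 0\<close> forces \<open>t \<ge> 0\<close>. So
  \<open>t \<sqdot> 1 + s \<sqdot> a \<mapsto> t\<close> is positive, and it extends to a nonzero positive functional \<open>\<phi>\<close> with \<open>\<phi> a = 0\<close>
  (\<open>ex_positive_functional_vanishing\<close>). So \<open>a\<close> is not strictly positive on the nonzero
  positive functionals. Nor is the seminorm of \<open>a = a\<^sup>1\<close> a norm, as its value at \<open>\<phi>\<close> is at most \<open>\<phi> a = 0\<close>.

  Both constructions of positive functionals come from one form of the Hahn-Banach theorem,
  \<open>cone_imp_linear_minorant\<close>. The order facts rest on the spectral theory of a self-adjoint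
  \<open>x\<close>: the spectrum is real (\<open>spectrum_selfadjoint_real\<close>) and contains a point of modulus
  \<open>norm x\<close> (\<open>ex_norm_in_spectrum\<close>). Powers require the continuous functional calculus
  (\<open>functional_calculus_exists\<close>), obtained by completing the polynomial calculus.
\<close>

section \<open>Linear minorants of sublinear functionals\<close>

text \<open>
  Positive homogeneity is asked for as an inequality, which is easier to establish for infima; applying it to
  \<open>c\<close> and \<open>1 / c\<close> gives equality (\<open>sublinear_scaleR\<close>).
\<close>

definition sublinear :: "('v::real_vector \<Rightarrow> real) \<Rightarrow> bool" where
  "sublinear p \<longleftrightarrow>
     (\<forall>x y. p (x + y) \<le> p x + p y) \<and> p 0 = 0 \<and> (\<forall>c>0. \<forall>x. p (c *\<^sub>R x) \<le> c * p x)"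

lemma sublinear_add: "sublinear p \<Longrightarrow> p (x + y) \<le> p x + p y"
  and sublinear_0: "sublinear p \<Longrightarrow> p 0 = 0"
  by (auto simp: sublinear_def)

lemma sublinear_minus: "sublinear p \<Longrightarrow> - p (- x) \<le> p x"
  using sublinear_add[of p x "- x"] sublinear_0[of p] by simp

lemma sublinear_scaleR:
  assumes "sublinear p" "0 \<le> c"
  shows "p (c *\<^sub>R x) = c * p x"
proof (cases "c = 0")
  case True
  then show ?thesis using assms by (simp add: sublinear_0)
next
  case False
  have "0 < inverse c" using assms False by simp
  then have "p (inverse c *\<^sub>R (c *\<^sub>R x)) \<le> inverse c * p (c *\<^sub>R x)"
    using assms(1) unfolding sublinear_def by blast
  then have "c * p x \<le> p (c *\<^sub>R x)"
    using assms False by (simp add: field_simps)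
  moreover have "p (c *\<^sub>R x) \<le> c * p x"
    using assms False unfolding sublinear_def by auto
  ultimately show ?thesis by simp
qed

text \<open>
  The infimum of a chain is again sublinear: in \<open>q x + r y\<close> with \<open>q\<close> and \<open>r\<close> from the chain, both can be
  replaced by the smaller of the two. The values stay bounded below because \<open>- p (- x) \<le> q x\<close>.
\<close>

lemma sublinear_chain_bound:
  assumes chain: "C \<in> Chains (relation_of (\<lambda>q r. r \<le> q) {q. sublinear q \<and> q \<le> p})"
    and "C \<noteq> {}"
  shows "sublinear (\<lambda>x. INF q\<in>C. q x)" "\<And>q. q \<in> C \<Longrightarrow> (\<lambda>x. INF q\<in>C. q x) \<le> q"
proof -
  have C: "sublinear q" "q \<le> p" if "q \<in> C" for q
    using that chain by (auto simp: Chains_def relation_of_def)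
  have tot: "q \<le> r \<or> r \<le> q" if "q \<in> C" "r \<in> C" for q r
    using that chain by (auto simp: Chains_def relation_of_def)
  have bdd: "bdd_below ((\<lambda>q. q x) ` C)" for x
  proof (rule bdd_belowI2)
    fix q assume q: "q \<in> C"
    show "- p (- x) \<le> q x"
      using sublinear_minus[OF C(1)[OF q], of x] C(2)[OF q] by (smt (verit) le_funD)
  qed
  have le: "(INF q\<in>C. q x) \<le> q x" if "q \<in> C" for q x
    using cINF_lower[OF bdd that] .
  show "\<And>q. q \<in> C \<Longrightarrow> (\<lambda>x. INF q\<in>C. q x) \<le> q"
    using le by (auto simp: le_fun_def)
  show "sublinear (\<lambda>x. INF q\<in>C. q x)"
    unfolding sublinear_def
  proof (intro conjI allI impI)
    fix x y
    have "(INF q\<in>C. q (x + y)) - q x \<le> (INF q\<in>C. q y)" if q: "q \<in> C" for q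
    proof (rule cINF_greatest[OF \<open>C \<noteq> {}\<close>])
      fix r assume r: "r \<in> C"
      show "(INF q\<in>C. q (x + y)) - q x \<le> r y"
        using tot[OF q r] le[OF q, of "x + y"] le[OF r, of "x + y"]
          sublinear_add[OF C(1)[OF q], of x y] sublinear_add[OF C(1)[OF r], of x y]
        by (smt (verit) le_funD)
    qed
    then have "(INF q\<in>C. q (x + y)) - (INF q\<in>C. q y) \<le> (INF q\<in>C. q x)"
      by (intro cINF_greatest[OF \<open>C \<noteq> {}\<close>]) (smt (verit))
    then show "(INF q\<in>C. q (x + y)) \<le> (INF q\<in>C. q x) + (INF q\<in>C. q y)"
      by simp
  next
    show "(INF q\<in>C. q 0) = 0"
      using \<open>C \<noteq> {}\<close> C by (simp add: sublinear_0)
  next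
    fix c :: real and x assume c: "0 < c"
    have "inverse c * (INF q\<in>C. q (c *\<^sub>R x)) \<le> (INF q\<in>C. q x)"
    proof (rule cINF_greatest[OF \<open>C \<noteq> {}\<close>])
      fix q assume q: "q \<in> C"
      show "inverse c * (INF q\<in>C. q (c *\<^sub>R x)) \<le> q x"
        using le[OF q, of "c *\<^sub>R x"] sublinear_scaleR[OF C(1)[OF q], of c x] c
        by (simp add: field_simps)
    qed
    then show "(INF q\<in>C. q (c *\<^sub>R x)) \<le> c * (INF q\<in>C. q x)"
      using c by (simp add: field_simps)
  qed
qed

text \<open>
  This shows that a minimal sublinear functional \<open>q\<close> is additive: the functional \<open>r\<close> below \<open>q\<close> must
  then be \<open>q\<close> itself, and the last inequality is the missing superadditivity of \<open>q\<close>.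
\<close>

lemma sublinear_tilt:
  fixes q :: "'v::real_vector \<Rightarrow> real" and y :: 'v
  assumes q: "sublinear q"
  obtains r where "sublinear r" "r \<le> q" "\<And>x. r x \<le> q (x + y) - q y"
proof
  define r where "r = (\<lambda>x. INF t\<in>{0..}. q (x + t *\<^sub>R y) - t * q y)"
  have low: "- q (- x) \<le> q (x + t *\<^sub>R y) - t * q y" if "0 \<le> t" for t x
    using sublinear_add[OF q, of "x + t *\<^sub>R y" "- x"] sublinear_scaleR[OF q that, of y] by simp
  have bdd: "bdd_below ((\<lambda>t. q (x + t *\<^sub>R y) - t * q y) ` {0..})" for x
    by (rule bdd_belowI2[of _ "- q (- x)"]) (use low in auto)
  have le: "r x \<le> q (x + t *\<^sub>R y) - t * q y" if "0 \<le> t" for t x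
    unfolding r_def by (rule cINF_lower[OF bdd]) (use that in auto)
  show "r \<le> q"
    using le[of 0] by (auto simp: le_fun_def)
  show "r x \<le> q (x + y) - q y" for x
    using le[of 1 x] by simp
  have ge: "m \<le> r x" if "\<And>t. 0 \<le> t \<Longrightarrow> m \<le> q (x + t *\<^sub>R y) - t * q y" for m x
    unfolding r_def by (rule cINF_greatest) (use that in auto)
  show "sublinear r"
    unfolding sublinear_def
  proof (intro conjI allI impI)
    fix x z
    have "r (x + z) - (q (x + s *\<^sub>R y) - s * q y) \<le> r z" if "0 \<le> s" for s
    proof (rule ge)
      fix t :: real assume "0 \<le> t"
      have "r (x + z) \<le> q (x + z + (s + t) *\<^sub>R y) - (s + t) * q y"
        using le[of "s + t" "x + z"] \<open>0 \<le> s\<close> \<open>0 \<le> t\<close> by simp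
      also have "x + z + (s + t) *\<^sub>R y = (x + s *\<^sub>R y) + (z + t *\<^sub>R y)"
        by (simp add: algebra_simps)
      also have "q \<dots> \<le> q (x + s *\<^sub>R y) + q (z + t *\<^sub>R y)"
        by (rule sublinear_add[OF q])
      finally show "r (x + z) - (q (x + s *\<^sub>R y) - s * q y) \<le> q (z + t *\<^sub>R y) - t * q y"
        by (simp add: algebra_simps)
    qed
    then have "r (x + z) - r z \<le> r x"
      by (intro ge) (smt (verit))
    then show "r (x + z) \<le> r x + r z" by simp
  next
    show "r 0 = 0"
      using le[of 0 0] ge[of 0 0] sublinear_0[OF q] sublinear_scaleR[OF q]
      by (intro antisym) auto
  next
    fix c :: real and x assume c: "0 < c"
    have "inverse c * r (c *\<^sub>R x) \<le> r x"
    proof (rule ge)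
      fix t :: real assume t: "0 \<le> t"
      have "r (c *\<^sub>R x) \<le> q (c *\<^sub>R (x + t *\<^sub>R y)) - (c * t) * q y"
        using le[of "c * t" "c *\<^sub>R x"] c t by (simp add: scaleR_add_right)
      also have "\<dots> = c * (q (x + t *\<^sub>R y) - t * q y)"
        using sublinear_scaleR[OF q, of c "x + t *\<^sub>R y"] c by (simp add: right_diff_distrib)
      finally show "inverse c * r (c *\<^sub>R x) \<le> q (x + t *\<^sub>R y) - t * q y"
        using c by (simp add: field_simps)
    qed
    then show "r (c *\<^sub>R x) \<le> c * r x" using c by (simp add: field_simps)
  qed
qed

text \<open>
  The core of the Hahn-Banach theorem: Zorn's lemma gives a minimal sublinear functional below \<open>p\<close>,
  and minimal ones are linear.
\<close>

theorem sublinear_imp_linear_minorant: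
  fixes p :: "'v::real_vector \<Rightarrow> real"
  assumes p: "sublinear p"
  obtains F where "linear F" "\<And>x. F x \<le> p x"
proof -
  let ?S = "{q. sublinear q \<and> q \<le> p}"
  have "\<exists>m\<in>?S. \<forall>q\<in>?S. q \<le> m \<longrightarrow> q = m"
  proof (rule predicate_Zorn)
    show "partial_order_on ?S (relation_of (\<lambda>q r. r \<le> q) ?S)"
      by (rule partial_order_on_relation_ofI) auto
  next
    fix C assume C: "C \<in> Chains (relation_of (\<lambda>q r. r \<le> q) ?S)"
    show "\<exists>u\<in>?S. \<forall>q\<in>C. u \<le> q"
    proof (cases "C = {}")
      case True
      then show ?thesis using p by auto
    next
      case False
      then obtain q where q: "q \<in> C" by auto
      then have "q \<le> p" using C by (auto simp: Chains_def relation_of_def)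
      then show ?thesis
        using sublinear_chain_bound[OF C False] q by (blast intro: order_trans)
    qed
  qed
  then obtain m where m: "sublinear m" "m \<le> p"
    and min: "\<And>q. sublinear q \<Longrightarrow> q \<le> p \<Longrightarrow> q \<le> m \<Longrightarrow> q = m"
    by auto
  have add: "m (x + y) = m x + m y" for x y
  proof -
    obtain r where r: "sublinear r" "r \<le> m" "\<And>x. r x \<le> m (x + y) - m y"
      using sublinear_tilt[OF m(1)] by blast
    then have "r = m" using min m(2) by (meson order_trans)
    then have "m x \<le> m (x + y) - m y" using r(3) by blast
    then show ?thesis using sublinear_add[OF m(1), of x y] by simp
  qed
  have neg: "m (- x) = - m x" for x
    using add[of x "- x"] sublinear_0[OF m(1)] by simp
  have "linear m"
  proof (rule linearI)
    fix c x
    show "m (c *\<^sub>R x) = c *\<^sub>R m x"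
    proof (cases "0 \<le> c")
      case True
      then show ?thesis using sublinear_scaleR[OF m(1)] by simp
    next
      case False
      then have "m ((- c) *\<^sub>R x) = (- c) * m x" using sublinear_scaleR[OF m(1), of "- c" x] by simp
      then show ?thesis using neg[of "c *\<^sub>R x"] by simp
    qed
  qed (rule add)
  then show thesis using that m(2) by (auto simp: le_fun_def)
qed

text \<open>
  Read a pair \<open>(x, r)\<close> of \<open>W\<close> as the demand \<open>F x \<le> r\<close>. A linear \<open>F\<close> can meet a convex cone of demands
  that bounds every vector as soon as the cone makes no contradictory demand \<open>F 0 \<le> r\<close> with \<open>r < 0\<close>.
  Prescribed values and positivity are both families of such demands, so this one
  statement covers the extension of positive functionals without introducing subspaces.
\<close>

theorem cone_imp_linear_minorant:
  fixes W :: "('v::real_vector \<times> real) set"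
  assumes add: "\<And>x r y s. (x, r) \<in> W \<Longrightarrow> (y, s) \<in> W \<Longrightarrow> (x + y, r + s) \<in> W"
    and scale: "\<And>c x r. 0 < c \<Longrightarrow> (x, r) \<in> W \<Longrightarrow> (c *\<^sub>R x, c * r) \<in> W"
    and total: "\<And>x. \<exists>r. (x, r) \<in> W"
    and nonneg: "\<And>r. (0, r) \<in> W \<Longrightarrow> 0 \<le> r"
  obtains F where "linear F" "\<And>x r. (x, r) \<in> W \<Longrightarrow> F x \<le> r"
proof -
  define p where "p = (\<lambda>x. Inf {r. (x, r) \<in> W})"
  have bdd: "bdd_below {r. (x, r) \<in> W}" for x
  proof -
    obtain s where s: "(- x, s) \<in> W" using total by auto
    have "- s \<le> r" if "(x, r) \<in> W" for r
      using nonneg[of "r + s"] add[OF that s] by simp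
    then show ?thesis by (intro bdd_belowI[of _ "- s"]) auto
  qed
  have le: "p x \<le> r" if "(x, r) \<in> W" for x r
    unfolding p_def using that by (intro cInf_lower bdd) auto
  have ge: "m \<le> p x" if "\<And>r. (x, r) \<in> W \<Longrightarrow> m \<le> r" for m x
    unfolding p_def using that total by (intro cInf_greatest) auto
  have "sublinear p"
    unfolding sublinear_def
  proof (intro conjI allI impI)
    fix x y
    have "p (x + y) - r \<le> p y" if "(x, r) \<in> W" for r
      by (rule ge) (use le[OF add[OF that]] in fastforce)
    then have "p (x + y) - p y \<le> p x"
      by (intro ge) (smt (verit))
    then show "p (x + y) \<le> p x + p y" by simp
  next
    show "p 0 = 0"
    proof (rule antisym)
      obtain r where r: "(0, r) \<in> W" using total by auto
      show "p 0 \<le> 0"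
      proof (rule field_le_epsilon)
        fix e :: real assume "0 < e"
        show "p 0 \<le> 0 + e"
        proof (cases "r \<le> e")
          case True
          then show ?thesis using le[OF r] by simp
        next
          case False
          then show ?thesis using le[OF scale[OF _ r, of "e / r"]] \<open>0 < e\<close> by simp
        qed
      qed
    qed (use ge nonneg in auto)
  next
    fix c :: real and x assume c: "0 < c"
    have "inverse c * p (c *\<^sub>R x) \<le> p x"
      by (rule ge) (use le[OF scale[OF c]] c in \<open>auto simp: field_simps\<close>)
    then show "p (c *\<^sub>R x) \<le> c * p x" using c by (simp add: field_simps)
  qed
  then obtain F where "linear F" "\<And>x. F x \<le> p x"
    using sublinear_imp_linear_minorant by blast
  then show thesis using that le by (meson order_trans)
qed

section \<open>Scalars and the involution\<close>

lemma scaleC_zero_right [simp]: "c *\<^sub>C (0::'a::cstar_algebra) = 0"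
  using scaleC_add_right[of c "0::'a" 0] by simp

lemma scaleC_zero_left [simp]: "0 *\<^sub>C (x::'a::cstar_algebra) = 0"
  using scaleR_scaleC[of 0 x] by simp

lemma scaleC_minus_right [simp]: "c *\<^sub>C (- x) = - (c *\<^sub>C (x::'a::cstar_algebra))"
  using scaleC_add_right[of c x "- x"] by (simp add: eq_neg_iff_add_eq_0 add.commute)

lemma scaleC_minus_left [simp]: "(- c) *\<^sub>C x = - (c *\<^sub>C (x::'a::cstar_algebra))"
  using scaleC_add_left[of c "- c" x] by (simp add: eq_neg_iff_add_eq_0 add.commute)

lemma scaleC_diff_right: "c *\<^sub>C (x - y) = c *\<^sub>C x - c *\<^sub>C (y::'a::cstar_algebra)"
  using scaleC_add_right[of c x "- y"] by simp

lemma scaleC_diff_left: "(c - d) *\<^sub>C x = c *\<^sub>C x - d *\<^sub>C (x::'a::cstar_algebra)"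
  using scaleC_add_left[of c "- d" x] by simp

lemmas scaleC_simps = scaleC_add_right scaleC_add_left scaleC_diff_right scaleC_diff_left
  scaleC_scaleC mult_scaleC_left mult_scaleC_right

lemma of_real_eq_scaleC: "(of_real r :: 'a::cstar_algebra) = complex_of_real r *\<^sub>C 1"
  by (simp add: of_real_def scaleR_scaleC)

lemma scaleC_scaleR_commute: "c *\<^sub>C (r *\<^sub>R x) = r *\<^sub>R (c *\<^sub>C (x::'a::cstar_algebra))"
  by (simp add: scaleR_scaleC scaleC_scaleC mult.commute)

lemma star_zero [simp]: "star (0::'a::cstar_algebra) = 0"
  using star_add[of "0::'a" 0] by simp

lemma star_minus [simp]: "star (- x) = - star (x::'a::cstar_algebra)"
  using star_add[of x "- x"] by (simp add: eq_neg_iff_add_eq_0 add.commute)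

lemma star_diff: "star (x - y) = star x - star (y::'a::cstar_algebra)"
  using star_add[of x "- y"] by simp

lemma star_one [simp]: "star (1::'a::cstar_algebra) = 1"
  using star_mult[of "star (1::'a)" 1] by (simp add: star_star)

lemma star_scaleR: "star (r *\<^sub>R x) = r *\<^sub>R star (x::'a::cstar_algebra)"
  by (simp add: scaleR_scaleC star_scaleC)

lemma star_of_real [simp]: "star (of_real r :: 'a::cstar_algebra) = of_real r"
  by (simp add: of_real_def star_scaleR)

lemma star_power: "star (x ^ n) = star (x::'a::cstar_algebra) ^ n"
  by (induction n) (simp_all add: star_mult power_commutes)

lemma norm_star [simp]: "norm (star x) = norm (x::'a::cstar_algebra)"
proof -
  have "norm y \<le> norm (star y)" for y :: 'a
  proof (cases "y = 0")
    case False
    have "norm y * norm y \<le> norm (star y) * norm y"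
      using cstar_identity[of y] norm_mult_ineq[of "star y" y] by (simp add: power2_eq_square)
    then show ?thesis using False by simp
  qed simp
  from this[of x] this[of "star x"] show ?thesis by (simp add: star_star)
qed

text \<open>
  The only use of the C*-identity in the spectral radius argument: powers of a self-adjoint element do
  not lose norm along exponents \<open>2 ^ k\<close>.
\<close>

lemma norm_power_two_power:
  fixes x :: "'a::cstar_algebra"
  assumes "star x = x"
  shows "norm (x ^ 2 ^ k) = norm x ^ 2 ^ k"
proof (induction k)
  case (Suc k)
  have "norm (x ^ 2 ^ Suc k) = norm (star (x ^ 2 ^ k) * x ^ 2 ^ k)"
    by (simp add: star_power assms mult_2 power_add)
  also have "\<dots> = norm x ^ 2 ^ Suc k"
    by (simp add: cstar_identity Suc.IH power2_eq_square mult_2 power_add)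
  finally show ?case .
qed simp

lemma invertible_elem_one [simp]: "invertible_elem (1::'a::cstar_algebra)"
  by (auto simp: invertible_elem_def)

lemma not_invertible_elem_zero [simp]: "\<not> invertible_elem (0::'a::cstar_algebra)"
  by (auto simp: invertible_elem_def)

section \<open>Invertible elements\<close>

lemma left_inverse_eq_right_inverse:
  fixes x :: "'a::monoid_mult"
  assumes "a * x = 1" "x * b = 1"
  shows "a = b"
proof -
  have "a = a * (x * b)" using assms(2) by simp
  also have "\<dots> = (a * x) * b" by (rule mult.assoc[symmetric])
  finally show ?thesis using assms(1) by simp
qed

lemma mult_cancel_inverse:
  fixes x :: "'a::monoid_mult"
  assumes "x * b = 1"
  shows "(z * x) * (b * y) = z * y"
proof -
  have "(z * x) * (b * y) = z * ((x * b) * y)" by (simp only: mult.assoc)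
  then show ?thesis by (simp add: assms)
qed

lemma invertible_elem_mult:
  assumes "invertible_elem x" "invertible_elem y"
  shows "invertible_elem (x * y)"
proof -
  obtain b c where "x * b = 1" "b * x = 1" "y * c = 1" "c * y = 1"
    using assms by (auto simp: invertible_elem_def)
  then have "(x * y) * (c * b) = 1" "(c * b) * (x * y) = 1"
    by (simp_all add: mult_cancel_inverse)
  then show ?thesis by (auto simp: invertible_elem_def)
qed

lemma invertible_elem_of_commuting_factor:
  assumes "invertible_elem (x * y)" "x * y = y * x"
  shows "invertible_elem x"
proof -
  obtain b where b: "(x * y) * b = 1" "b * (x * y) = 1"
    using assms(1) by (auto simp: invertible_elem_def)
  have "x * (y * b) = 1" using b(1) by (simp add: mult.assoc)
  moreover have "(b * y) * x = b * (x * y)" by (subst assms(2)) (rule mult.assoc)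
  then have "(b * y) * x = 1" using b(2) by simp
  ultimately show ?thesis
    using left_inverse_eq_right_inverse[of "b * y" x "y * b"] by (auto simp: invertible_elem_def)
qed

lemma invertible_elem_scaleC:
  assumes "invertible_elem x" "c \<noteq> 0"
  shows "invertible_elem (c *\<^sub>C x)"
proof -
  obtain b where "x * b = 1" "b * x = 1" using assms by (auto simp: invertible_elem_def)
  then show ?thesis
    unfolding invertible_elem_def using assms(2)
    by (intro exI[of _ "(1 / c) *\<^sub>C b"]) (simp add: scaleC_simps scaleC_one)
qed

lemma invertible_elem_scaleC_iff:
  "c \<noteq> 0 \<Longrightarrow> invertible_elem (c *\<^sub>C x) \<longleftrightarrow> invertible_elem x"
  using invertible_elem_scaleC[of x c] invertible_elem_scaleC[of "c *\<^sub>C x" "1 / c"]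
  by (auto simp: scaleC_simps scaleC_one)

text \<open>
  Neumann series.
\<close>

lemma invertible_elem_one_minus:
  fixes x :: "'a::cstar_algebra"
  assumes "norm x < 1"
  shows "invertible_elem (1 - x)"
proof -
  have sm: "summable (\<lambda>n. x ^ n)" by (rule complete_algebra_summable_geometric[OF assms])
  let ?s = "\<Sum>n. x ^ n"
  have split: "?s = 1 + (\<Sum>n. x ^ Suc n)"
    using suminf_split_head[OF sm] by simp
  have "x * ?s = (\<Sum>n. x ^ Suc n)"
    using suminf_mult[OF sm, of x] by simp
  moreover have "?s * x = (\<Sum>n. x ^ Suc n)"
    using suminf_mult2[OF sm, of x] by (simp add: power_commutes)
  ultimately have "(1 - x) * ?s = 1" "?s * (1 - x) = 1"
    using split by (simp_all add: algebra_simps)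
  then show ?thesis by (auto simp: invertible_elem_def)
qed

definition inv_elem :: "'a::cstar_algebra \<Rightarrow> 'a" where
  "inv_elem x = (SOME y. x * y = 1 \<and> y * x = 1)"

lemma
  assumes "invertible_elem x"
  shows inv_elem_right: "x * inv_elem x = 1" and inv_elem_left: "inv_elem x * x = 1"
  using someI_ex[OF assms[unfolded invertible_elem_def]] by (simp_all add: inv_elem_def)

lemma inv_elem_unique:
  assumes "x * y = 1" "y * x = 1"
  shows "inv_elem x = y"
proof -
  have "invertible_elem x" using assms by (auto simp: invertible_elem_def)
  then show ?thesis using left_inverse_eq_right_inverse[OF inv_elem_left assms(1)] by simp
qed

lemma invertible_elem_perturb:
  fixes x y :: "'a::cstar_algebra"
  assumes x: "invertible_elem x" and small: "norm (inv_elem x) * norm (x - y) < 1"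
  shows "invertible_elem y"
proof -
  have "norm (inv_elem x * (x - y)) < 1"
    using norm_mult_ineq small by (rule le_less_trans)
  then have "invertible_elem (x * (1 - inv_elem x * (x - y)))"
    by (intro invertible_elem_mult invertible_elem_one_minus x)
  also have "x * (1 - inv_elem x * (x - y)) = y"
    using inv_elem_right[OF x] by (simp add: right_diff_distrib flip: mult.assoc)
  finally show ?thesis .
qed

text \<open>
  From \<open>inv_elem y - inv_elem x = inv_elem y * (x - y) * inv_elem x\<close>. The smallness assumption
  bounds \<open>inv_elem y\<close> by \<open>2 * norm (inv_elem x)\<close>, which makes inversion locally Lipschitz.
\<close>

lemma norm_inv_elem_diff_le:
  fixes x y :: "'a::cstar_algebra"
  assumes x: "invertible_elem x" and y: "invertible_elem y"
    and small: "norm (inv_elem x) * norm (x - y) \<le> 1 / 2"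
  shows "norm (inv_elem y - inv_elem x) \<le> 2 * (norm (inv_elem x))\<^sup>2 * norm (x - y)"
proof -
  let ?b = "inv_elem x" and ?d = "inv_elem y"
  have eq: "?d - ?b = ?d * (x - y) * ?b"
    using inv_elem_right[OF x] inv_elem_left[OF y]
    by (simp add: right_diff_distrib left_diff_distrib mult.assoc)
  have le: "norm (?d - ?b) \<le> norm ?d * (norm ?b * norm (x - y))"
  proof -
    have "norm (?d - ?b) \<le> norm ?d * norm (x - y) * norm ?b"
      unfolding eq by (meson norm_mult_ineq mult_right_mono norm_ge_zero order_trans)
    then show ?thesis by (simp add: mult_ac)
  qed
  also have "\<dots> \<le> norm ?d * (1 / 2)" by (intro mult_left_mono small) simp
  finally have "norm ?d \<le> 2 * norm ?b"
    using norm_triangle_ineq2[of ?d ?b] by simp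
  then have "norm ?d * (norm ?b * norm (x - y)) \<le> (2 * norm ?b) * (norm ?b * norm (x - y))"
    by (intro mult_right_mono) auto
  with le show ?thesis by (simp add: power2_eq_square mult_ac)
qed

lemma continuous_on_inv_elem:
  assumes f: "continuous_on S f" and inv: "\<And>t. t \<in> S \<Longrightarrow> invertible_elem (f t)"
  shows "continuous_on S (\<lambda>t. inv_elem (f t :: 'a::cstar_algebra))"
  unfolding continuous_on_def
proof
  fix t assume t: "t \<in> S"
  let ?b = "norm (inv_elem (f t))"
  have lim: "(f \<longlongrightarrow> f t) (at t within S)" using f t by (auto simp: continuous_on_def)
  have nl: "((\<lambda>s. norm (f t - f s)) \<longlongrightarrow> 0) (at t within S)"
    using tendsto_norm[OF tendsto_diff[OF tendsto_const[of "f t"] lim]] by simp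
  have "((\<lambda>s. ?b * norm (f t - f s)) \<longlongrightarrow> 0) (at t within S)"
    using tendsto_mult_left[OF nl, of ?b] by simp
  then have small: "eventually (\<lambda>s. ?b * norm (f t - f s) < 1 / 2) (at t within S)"
    by (rule order_tendstoD) simp
  have inS: "eventually (\<lambda>s. s \<in> S) (at t within S)"
    by (simp add: eventually_at_filter)
  have "((\<lambda>s. inv_elem (f s) - inv_elem (f t)) \<longlongrightarrow> 0) (at t within S)"
  proof (rule tendsto_0_le[OF nl, of _ "2 * ?b\<^sup>2"])
    show "\<forall>\<^sub>F s in at t within S.
        norm (inv_elem (f s) - inv_elem (f t)) \<le> norm (norm (f t - f s)) * (2 * ?b\<^sup>2)"
      using small inS
    proof eventually_elim
      case (elim s)
      then show ?case
        using norm_inv_elem_diff_le[OF inv[OF t] inv, of s] by (simp add: mult_ac)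
    qed
  qed
  then show "((\<lambda>s. inv_elem (f s)) \<longlongrightarrow> inv_elem (f t)) (at t within S)"
    by (simp add: LIM_zero_iff)
qed

section \<open>The spectral radius of a self-adjoint element\<close>

lemma norm_inv_one_minus_diff_le:
  fixes x :: "'a::cstar_algebra"
  assumes "norm x \<le> 1 / 8"
  shows "norm (inv_elem (1 - x) - 1) \<le> 1 / 7"
proof -
  let ?b = "inv_elem (1 - x)"
  have "(1 - x) * ?b = 1"
    using assms by (intro inv_elem_right invertible_elem_one_minus) simp
  then have eq: "?b - 1 = x * ?b" by (simp add: algebra_simps)
  have "norm (?b - 1) \<le> 1 / 8 * norm ?b"
    unfolding eq using mult_right_mono[OF assms norm_ge_zero[of ?b]] norm_mult_ineq[of x ?b] by simp
  moreover have "norm ?b \<le> norm (?b - 1) + 1"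
    using norm_triangle_ineq[of "?b - 1" 1] by simp
  ultimately show ?thesis by simp
qed

lemma norm_lt_one_of_inv_one_minus:
  fixes x :: "'a::cstar_algebra"
  assumes inv: "invertible_elem (1 - x)" and le: "norm (inv_elem (1 - x) - 1) < 1 / 2"
  shows "norm x < 1"
proof -
  let ?w = "inv_elem (1 - x) - 1"
  have "(1 - x) * (1 + ?w) = 1" using inv_elem_right[OF inv] by simp
  then have eq: "x = ?w - x * ?w" by (simp add: algebra_simps)
  have "norm x \<le> norm ?w + norm x * norm ?w"
    by (subst eq) (meson norm_triangle_ineq4 norm_mult_ineq add_left_mono order_trans)
  also have "\<dots> \<le> norm ?w + norm x * (1 / 2)"
    using le by (intro add_left_mono mult_left_mono) auto
  finally show ?thesis using le by simp
qed

text \<open>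
  The partial fraction \<open>1 / (1 - y\<^sup>2) = (1 / (1 - y) + 1 / (1 + y)) / 2\<close>. Iterating it writes the resolvent
  of \<open>x ^ 2 ^ k\<close> as an average of resolvents of \<open>x\<close> over roots of unity.
\<close>

lemma inv_one_minus_square:
  fixes y :: "'a::cstar_algebra"
  assumes u: "invertible_elem (1 - y)" and v: "invertible_elem (1 + y)"
  shows "invertible_elem (1 - y * y)"
    and "inv_elem (1 - y * y) = (1 / 2) *\<^sub>R (inv_elem (1 - y) + inv_elem (1 + y))"
proof -
  let ?u = "inv_elem (1 - y)" and ?v = "inv_elem (1 + y)"
  note inv = inv_elem_right[OF u] inv_elem_left[OF u] inv_elem_right[OF v] inv_elem_left[OF v]
  have f: "1 - y * y = (1 + y) * (1 - y)" "1 - y * y = (1 - y) * (1 + y)"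
    by (simp_all add: algebra_simps)
  show "invertible_elem (1 - y * y)" unfolding f(1) by (intro invertible_elem_mult u v)
  have "(1 - y * y) * ?u = 1 + y"
    unfolding f(1) mult.assoc inv by simp
  moreover have "(1 - y * y) * ?v = 1 - y"
    unfolding f(2) mult.assoc inv by simp
  moreover have "?u * (1 - y * y) = 1 + y"
    unfolding f(2) mult.assoc[symmetric] inv by simp
  moreover have "?v * (1 - y * y) = 1 - y"
    unfolding f(1) mult.assoc[symmetric] inv by simp
  ultimately have "(1 - y * y) * (?u + ?v) = 2 *\<^sub>R 1" "(?u + ?v) * (1 - y * y) = 2 *\<^sub>R 1"
    by (simp_all only: distrib_left distrib_right) (simp_all add: scaleR_2)
  then show "inv_elem (1 - y * y) = (1 / 2) *\<^sub>R (?u + ?v)"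
    by (intro inv_elem_unique) simp_all
qed

lemma power_scaleC: "(c *\<^sub>C x) ^ n = c ^ n *\<^sub>C (x::'a::cstar_algebra) ^ n"
  by (induction n) (simp_all add: scaleC_simps scaleC_one mult_ac)

lemma ex_root_of_minus_one: "\<exists>\<omega>. cmod \<omega> = 1 \<and> \<omega> ^ 2 ^ k = - 1"
proof
  show "cmod (cis (pi / 2 ^ k)) = 1 \<and> cis (pi / 2 ^ k) ^ 2 ^ k = - 1"
    by (simp add: Complex.DeMoivre)
qed

text \<open>
  An average over rotations inherits every modulus of continuity of the original function on the
  disc, so the estimate \<open>e\<close> is the same for all \<open>k\<close>. In the step, \<open>1 + (z x) ^ 2 ^ k\<close> is
  \<open>1 - (\<omega> z x) ^ 2 ^ k\<close> for a rotation \<open>\<omega>\<close> with \<open>\<omega> ^ 2 ^ k = - 1\<close>.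
\<close>

lemma resolvent_averages:
  fixes x :: "'a::cstar_algebra"
  assumes inv: "\<And>z. cmod z \<le> 1 \<Longrightarrow> invertible_elem (1 - z *\<^sub>C x)"
    and close: "\<And>z w. cmod z \<le> 1 \<Longrightarrow> cmod w \<le> 1 \<Longrightarrow> cmod (z - w) < d \<Longrightarrow>
      norm (inv_elem (1 - z *\<^sub>C x) - inv_elem (1 - w *\<^sub>C x)) \<le> e"
  shows "(\<forall>z. cmod z \<le> 1 \<longrightarrow> invertible_elem (1 - (z *\<^sub>C x) ^ 2 ^ k)) \<and>
    (\<forall>z w. cmod z \<le> 1 \<longrightarrow> cmod w \<le> 1 \<longrightarrow> cmod (z - w) < d \<longrightarrow>
      norm (inv_elem (1 - (z *\<^sub>C x) ^ 2 ^ k) - inv_elem (1 - (w *\<^sub>C x) ^ 2 ^ k)) \<le> e)"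
proof (induction k)
  case 0
  then show ?case using inv close by simp
next
  case (Suc k)
  obtain \<omega> where \<omega>: "cmod \<omega> = 1" "\<omega> ^ 2 ^ k = - 1" using ex_root_of_minus_one by blast
  have plus: "1 + (z *\<^sub>C x) ^ 2 ^ k = 1 - ((\<omega> * z) *\<^sub>C x) ^ 2 ^ k" for z
    by (simp add: power_scaleC power_mult_distrib \<omega>)
  have sq: "(z *\<^sub>C x) ^ 2 ^ Suc k = (z *\<^sub>C x) ^ 2 ^ k * (z *\<^sub>C x) ^ 2 ^ k" for z
    by (simp add: mult_2 power_add)
  have i: "invertible_elem (1 - (z *\<^sub>C x) ^ 2 ^ k)" "invertible_elem (1 + (z *\<^sub>C x) ^ 2 ^ k)"
    if "cmod z \<le> 1" for z
    using Suc.IH that unfolding plus by (simp_all add: norm_mult \<omega>)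
  note avg = inv_one_minus_square[OF i, folded sq]
  show ?case
  proof (intro conjI allI impI)
    fix z assume z: "cmod z \<le> 1"
    show "invertible_elem (1 - (z *\<^sub>C x) ^ 2 ^ Suc k)" by (rule avg(1)[OF z z])
  next
    fix z w :: complex assume zw: "cmod z \<le> 1" "cmod w \<le> 1" "cmod (z - w) < d"
    let ?S = "\<lambda>z. inv_elem (1 - (z *\<^sub>C x) ^ 2 ^ k)"
    have "cmod (\<omega> * z - \<omega> * w) < d"
      using zw(3) by (simp add: norm_mult \<omega> flip: right_diff_distrib)
    then have le: "norm (?S z - ?S w) \<le> e" "norm (?S (\<omega> * z) - ?S (\<omega> * w)) \<le> e"
      using Suc.IH zw by (simp_all add: norm_mult \<omega>)
    have "inv_elem (1 - (z *\<^sub>C x) ^ 2 ^ Suc k) - inv_elem (1 - (w *\<^sub>C x) ^ 2 ^ Suc k)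
        = (1 / 2) *\<^sub>R ((?S z - ?S w) + (?S (\<omega> * z) - ?S (\<omega> * w)))"
      unfolding avg(2)[OF zw(1) zw(1)] avg(2)[OF zw(2) zw(2)] plus by (simp add: algebra_simps)
    also have "norm \<dots> \<le> 1 / 2 * (e + e)"
      using norm_triangle_mono[OF le] by simp
    finally show "norm (inv_elem (1 - (z *\<^sub>C x) ^ 2 ^ Suc k) -
        inv_elem (1 - (w *\<^sub>C x) ^ 2 ^ Suc k)) \<le> e" by simp
  qed
qed

text \<open>
  An elementary replacement for Liouville's theorem in the spectral radius formula. For
  \<open>\<mu> < 1\<close> the powers \<open>(\<mu> x) ^ 2 ^ n\<close> tend to \<open>0\<close>, so the resolvent \<open>inv_elem (1 - (\<mu> x) ^ 2 ^ n)\<close> is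
  close to \<open>1\<close>. By the uniform estimate of \<open>resolvent_averages\<close>, for \<open>\<mu>\<close> close to \<open>1\<close> the
  resolvent of \<open>x ^ 2 ^ n\<close> itself is close to \<open>1\<close>, which bounds \<open>x ^ 2 ^ n\<close>.
\<close>

theorem norm_power_lt_one_of_resolvent:
  fixes x :: "'a::cstar_algebra"
  assumes norm: "norm x \<le> 1"
    and inv: "\<And>z. cmod z \<le> 1 \<Longrightarrow> invertible_elem (1 - z *\<^sub>C x)"
  shows "\<exists>k. norm (x ^ 2 ^ k) < 1"
proof -
  have scaleC_cont: "continuous_on S (\<lambda>z. z *\<^sub>C x)" for S
  proof (rule bounded_linear.continuous_on[OF _ continuous_on_id])
    show "bounded_linear (\<lambda>z. z *\<^sub>C x)"
      by (rule bounded_linear_intro[where K = "norm x"])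
        (auto simp: scaleC_simps scaleR_scaleC scaleR_conv_of_real norm_scaleC)
  qed
  have "continuous_on (cball 0 1) (\<lambda>z. inv_elem (1 - z *\<^sub>C x))"
    by (intro continuous_on_inv_elem continuous_intros scaleC_cont) (simp add: inv)
  then have "uniformly_continuous_on (cball 0 1) (\<lambda>z. inv_elem (1 - z *\<^sub>C x))"
    by (rule compact_uniformly_continuous) simp
  then have "\<exists>d>0. \<forall>z\<in>cball 0 1. \<forall>w\<in>cball 0 1. dist w z < d \<longrightarrow>
      dist (inv_elem (1 - w *\<^sub>C x)) (inv_elem (1 - z *\<^sub>C x)) < 1 / 8"
    unfolding uniformly_continuous_on_def by (rule allE[of _ "1 / 8"]) auto
  then obtain d where d: "0 < d" and close: "\<And>z w. cmod z \<le> 1 \<Longrightarrow> cmod w \<le> 1 \<Longrightarrow>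
      cmod (z - w) < d \<Longrightarrow> norm (inv_elem (1 - z *\<^sub>C x) - inv_elem (1 - w *\<^sub>C x)) \<le> 1 / 8"
    by (force simp: dist_norm)
  note avg = resolvent_averages[OF inv close]
  \<comment> \<open>The maximum keeps \<open>\<mu>\<close> in the disc when \<open>d\<close> is large.\<close>
  define \<mu> where "\<mu> = max 0 (1 - d / 2)"
  have \<mu>: "0 \<le> \<mu>" "\<mu> < 1" "1 - \<mu> < d" using d by (auto simp: \<mu>_def)
  obtain n where n: "\<mu> ^ n < 1 / 8" using real_arch_pow_inv[of "1 / 8" \<mu>] \<mu> by auto
  have "\<mu> ^ 2 ^ n \<le> \<mu> ^ n" using \<mu> by (intro power_decreasing) (auto intro: less_imp_le less_exp)
  then have small: "norm ((of_real \<mu> *\<^sub>C x) ^ 2 ^ n) \<le> 1 / 8"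
  proof -
    have "norm (x ^ 2 ^ n) \<le> 1"
      using norm_power_ineq[of x "2 ^ n"] power_le_one[OF norm_ge_zero norm, of "2 ^ n"] by linarith
    then have "\<mu> ^ 2 ^ n * norm (x ^ 2 ^ n) \<le> \<mu> ^ 2 ^ n * 1"
      using \<mu> by (intro mult_left_mono) auto
    then show ?thesis using \<open>\<mu> ^ 2 ^ n \<le> \<mu> ^ n\<close> n \<mu>
      by (simp add: power_scaleC norm_scaleC norm_power)
  qed
  have "norm (inv_elem (1 - (1 *\<^sub>C x) ^ 2 ^ n) - inv_elem (1 - (of_real \<mu> *\<^sub>C x) ^ 2 ^ n)) \<le> 1 / 8"
  proof -
    have "cmod (of_real (1 - \<mu>)) < d" unfolding norm_of_real using \<mu> by simp
    then have "cmod (1 - of_real \<mu>) < d" by (simp only: of_real_diff of_real_1)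
    then show ?thesis using avg[where k = n] \<mu> by simp
  qed
  with norm_inv_one_minus_diff_le[OF small]
  have "norm (inv_elem (1 - (1 *\<^sub>C x) ^ 2 ^ n) - 1) \<le> 1 / 8 + 1 / 7"
    using norm_triangle_mono by fastforce
  moreover have "invertible_elem (1 - (1 *\<^sub>C x) ^ 2 ^ n)" using avg[where k = n] by simp
  ultimately have "norm (x ^ 2 ^ n) < 1"
    using norm_lt_one_of_inv_one_minus[of "x ^ 2 ^ n"] by (simp add: scaleC_one)
  then show ?thesis ..
qed

section \<open>Spectra\<close>

lemma mem_spectrum_iff: "z \<in> spectrum x \<longleftrightarrow> \<not> invertible_elem (x - z *\<^sub>C 1)"
  by (simp add: spectrum_def)

lemma spectrum_affine:
  fixes x :: "'a::cstar_algebra"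
  assumes "\<beta> \<noteq> 0"
  shows "\<alpha> + \<beta> * z \<in> spectrum (\<alpha> *\<^sub>C 1 + \<beta> *\<^sub>C x) \<longleftrightarrow> z \<in> spectrum x"
proof -
  have "\<alpha> *\<^sub>C 1 + \<beta> *\<^sub>C x - (\<alpha> + \<beta> * z) *\<^sub>C 1 = \<beta> *\<^sub>C (x - z *\<^sub>C 1)"
    by (simp add: scaleC_simps)
  then show ?thesis by (simp add: mem_spectrum_iff invertible_elem_scaleC_iff assms)
qed

lemma spectrum_of_real_minus:
  fixes x :: "'a::cstar_algebra"
  shows "z \<in> spectrum (of_real t - x) \<longleftrightarrow> of_real t - z \<in> spectrum x"
  using spectrum_affine[of "- 1" "of_real t" "of_real t - z" x]
  by (simp add: of_real_eq_scaleC scaleC_one)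

lemma norm_ge_of_mem_spectrum:
  fixes x :: "'a::cstar_algebra"
  assumes "z \<in> spectrum x"
  shows "cmod z \<le> norm x"
proof (rule ccontr)
  assume "\<not> cmod z \<le> norm x"
  then have z: "norm x < cmod z" "z \<noteq> 0" by auto
  then have "invertible_elem (1 - (1 / z) *\<^sub>C x)"
    by (intro invertible_elem_one_minus) (simp add: norm_scaleC norm_divide field_simps)
  then have "invertible_elem ((- z) *\<^sub>C (1 - (1 / z) *\<^sub>C x))"
    using z by (simp only: invertible_elem_scaleC_iff neg_equal_0_iff_equal not_False_eq_True)
  also have "(- z) *\<^sub>C (1 - (1 / z) *\<^sub>C x) = x - z *\<^sub>C 1"
    using z by (simp add: scaleC_simps scaleC_one)
  finally show False using assms by (simp add: mem_spectrum_iff)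
qed

lemma closed_spectrum: "closed (spectrum (x::'a::cstar_algebra))"
  unfolding closed_def open_dist
proof
  fix z assume "z \<in> - spectrum x"
  then have inv: "invertible_elem (x - z *\<^sub>C 1)" by (simp add: mem_spectrum_iff)
  let ?b = "norm (inv_elem (x - z *\<^sub>C 1)) + 1"
  have b: "0 < ?b" by (simp add: add_nonneg_pos)
  have "w \<in> - spectrum x" if "dist w z < 1 / ?b" for w
  proof -
    have eq: "x - z *\<^sub>C 1 - (x - w *\<^sub>C 1) = (w - z) *\<^sub>C 1" by (simp add: scaleC_simps)
    have "norm (inv_elem (x - z *\<^sub>C 1)) * cmod (w - z) \<le> ?b * cmod (w - z)"
      by (intro mult_right_mono) auto
    also have "\<dots> < 1" using that b by (simp add: dist_norm field_simps)
    finally have "invertible_elem (x - w *\<^sub>C 1)"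
      by (intro invertible_elem_perturb[OF inv]) (simp add: eq norm_scaleC)
    then show ?thesis by (simp add: mem_spectrum_iff)
  qed
  then show "\<exists>e>0. \<forall>w. dist w z < e \<longrightarrow> w \<in> - spectrum x"
    using b by (intro exI[of _ "1 / ?b"]) simp
qed

lemma compact_spectrum: "compact (spectrum (x::'a::cstar_algebra))"
  using closed_spectrum norm_ge_of_mem_spectrum
  by (auto simp: compact_eq_bounded_closed bounded_iff)

text \<open>
  Scaled to norm \<open>1\<close>, a self-adjoint element has \<open>norm (x ^ 2 ^ k) = 1\<close> for all \<open>k\<close>. If no point of
  the spectrum had modulus \<open>1\<close>, the resolvent would be defined on the whole closed disc, against
  \<open>norm_power_lt_one_of_resolvent\<close>.
\<close>

theorem ex_norm_in_spectrum:
  fixes x :: "'a::cstar_algebra"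
  assumes sa: "star x = x"
  shows "\<exists>z\<in>spectrum x. cmod z = norm x"
proof (cases "x = 0")
  case True
  then show ?thesis by (intro bexI[of _ 0]) (auto simp: mem_spectrum_iff)
next
  case False
  show ?thesis
  proof (rule ccontr)
    assume none: "\<not> (\<exists>z\<in>spectrum x. cmod z = norm x)"
    define y where "y = complex_of_real (1 / norm x) *\<^sub>C x"
    have ny: "norm y = 1" using False by (simp add: y_def norm_scaleC norm_divide)
    have sy: "star y = y" by (simp add: y_def star_scaleC sa)
    have "invertible_elem (1 - z *\<^sub>C y)" if z: "cmod z \<le> 1" for z
    proof (cases "z = 0")
      case True
      then show ?thesis by simp
    next
      case nz: False
      let ?w = "of_real (norm x) / z"
      have "norm x \<le> cmod ?w" using z nz False by (simp add: norm_divide field_simps)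
      then have "?w \<notin> spectrum x" using none norm_ge_of_mem_spectrum[of ?w x] by auto
      then have "invertible_elem ((- (1 / ?w)) *\<^sub>C (x - ?w *\<^sub>C 1))"
        using nz False by (intro invertible_elem_scaleC) (auto simp: mem_spectrum_iff)
      also have "(- (1 / ?w)) *\<^sub>C (x - ?w *\<^sub>C 1) = 1 - z *\<^sub>C y"
        using nz False by (simp add: scaleC_simps scaleC_one y_def)
      finally show ?thesis .
    qed
    then obtain k where "norm (y ^ 2 ^ k) < 1"
      using norm_power_lt_one_of_resolvent[of y] ny by auto
    then show False using norm_power_two_power[OF sy] ny by simp
  qed
qed

text \<open>
  Arens' shift: \<open>\<i> t + z\<close> lies in the spectrum of \<open>\<i> t + x\<close>, whose squared norm is at most
  \<open>(norm x)\<^sup>2 + t\<^sup>2\<close> by the C*-identity. As \<open>(Im z + t)\<^sup>2\<close> contains the cross term \<open>2 t Im z\<close>, this fails for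
  large \<open>t\<close> of the sign of \<open>Im z\<close> unless \<open>Im z = 0\<close>.
\<close>

lemma spectrum_selfadjoint_real:
  fixes x :: "'a::cstar_algebra"
  assumes sa: "star x = x" and z: "z \<in> spectrum x"
  shows "Im z = 0"
proof (rule ccontr)
  assume ne: "Im z \<noteq> 0"
  have key: "(Re z)\<^sup>2 + (Im z + t)\<^sup>2 \<le> (norm x)\<^sup>2 + t\<^sup>2" for t
  proof -
    let ?y = "(\<i> * of_real t) *\<^sub>C 1 + 1 *\<^sub>C x"
    have sy: "star ?y * ?y = x * x + of_real (t\<^sup>2)"
      by (simp add: star_add star_scaleC sa scaleC_one algebra_simps scaleC_simps
          of_real_eq_scaleC power2_eq_square)
    have "\<i> * of_real t + 1 * z \<in> spectrum ?y" using z by (simp only: spectrum_affine one_neq_zero not_False_eq_True)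
    then have "cmod (\<i> * of_real t + z) \<le> norm ?y" using norm_ge_of_mem_spectrum by fastforce
    then have "(cmod (\<i> * of_real t + z))\<^sup>2 \<le> (norm ?y)\<^sup>2" by (simp add: power_mono)
    also have "\<dots> = norm (x * x + of_real (t\<^sup>2))" by (simp only: sy flip: cstar_identity)
    also have "\<dots> \<le> norm (x * x) + norm (of_real (t\<^sup>2) :: 'a)" by (rule norm_triangle_ineq)
    also have "\<dots> \<le> (norm x)\<^sup>2 + t\<^sup>2"
      using norm_mult_ineq[of x x] unfolding norm_of_real by (simp add: power2_eq_square)
    finally show ?thesis by (simp add: cmod_power2 add_ac)
  qed
  \<comment> \<open>For this t the cross term \<open>2 * t * Im z\<close> is \<open>(norm x)\<^sup>2 + 1\<close>.\<close>
  from key[of "((norm x)\<^sup>2 + 1) / (2 * Im z)"] ne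
  have "(Re z)\<^sup>2 + (Im z)\<^sup>2 + ((norm x)\<^sup>2 + 1) \<le> (norm x)\<^sup>2"
    by (simp add: power2_sum)
  then show False by (smt (verit) zero_le_power2)
qed

section \<open>The positive cone\<close>

lemma positive_cone_iff:
  "x \<in> positive_cone \<longleftrightarrow> star x = x \<and> (\<forall>z\<in>spectrum x. 0 \<le> Re z)"
  using spectrum_selfadjoint_real[of x]
  by (auto simp: positive_cone_def nonneg_Reals_def complex_eq_iff complex_nonneg_Reals_iff)

lemma star_of_positive: "x \<in> positive_cone \<Longrightarrow> star x = x"
  by (simp add: positive_cone_def)

lemma positive_of_norm_le:
  fixes x :: "'a::cstar_algebra"
  assumes "star x = x" "norm (of_real t - x) \<le> t"
  shows "x \<in> positive_cone"
proof -
  have "0 \<le> Re z" if "z \<in> spectrum x" for z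
  proof -
    have "of_real t - z \<in> spectrum (of_real t - x)"
      using that by (simp add: spectrum_of_real_minus)
    then have "cmod (of_real t - z) \<le> t"
      using norm_ge_of_mem_spectrum assms(2) by fastforce
    then show ?thesis using abs_Re_le_cmod[of "of_real t - z"] by simp
  qed
  then show ?thesis using assms(1) by (auto simp: positive_cone_iff)
qed

lemma norm_le_of_positive:
  fixes x :: "'a::cstar_algebra"
  assumes "of_real t - x \<in> positive_cone" "of_real t + x \<in> positive_cone"
  shows "norm x \<le> t"
proof -
  have "star (of_real t - x) = of_real t - x" using assms(1) by (rule star_of_positive)
  then have sa: "star x = x" by (simp add: star_diff)
  obtain z where z: "z \<in> spectrum x" "cmod z = norm x" using ex_norm_in_spectrum[OF sa] by blast
  have "of_real t - z \<in> spectrum (of_real t - x)"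
    using z by (simp add: spectrum_of_real_minus)
  moreover have "of_real t + z \<in> spectrum (of_real t + x)"
    using z(1) spectrum_affine[of 1 "of_real t" z x] by (simp add: of_real_eq_scaleC scaleC_one)
  ultimately have "0 \<le> Re (of_real t - z)" "0 \<le> Re (of_real t + z)"
    using assms positive_cone_iff by blast+
  moreover have "cmod z = \<bar>Re z\<bar>"
    using spectrum_selfadjoint_real[OF sa z(1)] by (simp add: cmod_def)
  ultimately show ?thesis using z(2) by simp
qed

text \<open>
  Positivity is a norm condition: a self-adjoint \<open>u\<close> is positive iff \<open>norm (t - u) \<le> t\<close> for some
  \<open>t\<close>, and for positive \<open>u\<close> the value \<open>t = norm u\<close> will do. Such norm conditions add up.
\<close>

lemma positive_add:
  fixes x y :: "'a::cstar_algebra"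
  assumes "x \<in> positive_cone" "y \<in> positive_cone"
  shows "x + y \<in> positive_cone"
proof -
  have *: "norm (of_real (norm u) - u) \<le> norm u" if u: "u \<in> positive_cone" for u :: 'a
  proof -
    let ?v = "of_real (norm u) - u"
    have sa: "star u = u" "star ?v = ?v" using u by (simp_all add: star_of_positive star_diff)
    obtain z where z: "z \<in> spectrum ?v" "cmod z = norm ?v" using ex_norm_in_spectrum[OF sa(2)] by blast
    let ?w = "of_real (norm u) - z"
    have w: "?w \<in> spectrum u" using z(1) by (simp add: spectrum_of_real_minus)
    then have "0 \<le> Re ?w" "Im ?w = 0" "cmod ?w \<le> norm u"
      using u positive_cone_iff spectrum_selfadjoint_real[OF sa(1)] norm_ge_of_mem_spectrum by blast+
    then show ?thesis
      using z(2) abs_Re_le_cmod[of ?w] by (simp add: cmod_def[of z])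
  qed
  show ?thesis
  proof (rule positive_of_norm_le)
    show "star (x + y) = x + y" using assms by (simp add: star_add star_of_positive)
    have "of_real (norm x + norm y) - (x + y) = (of_real (norm x) - x) + (of_real (norm y) - y)"
      by simp
    then show "norm (of_real (norm x + norm y) - (x + y)) \<le> norm x + norm y"
      using norm_triangle_mono[OF *[OF assms(1)] *[OF assms(2)]] by (simp add: algebra_simps)
  qed
qed

lemma norm_minus_selfadjoint_positive:
  "star x = x \<Longrightarrow> norm x \<le> t \<Longrightarrow> of_real t - x \<in> positive_cone"
  for x :: "'a::cstar_algebra"
  by (rule positive_of_norm_le[of _ t]) (simp_all add: star_diff)

lemma positive_of_real: "0 \<le> t \<Longrightarrow> of_real t \<in> positive_cone"
  by (rule positive_of_norm_le[of _ t]) simp_all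

lemma positive_scaleR:
  fixes x :: "'a::cstar_algebra"
  assumes "0 \<le> c" "x \<in> positive_cone"
  shows "c *\<^sub>R x \<in> positive_cone"
proof (cases "c = 0")
  case True
  then show ?thesis using positive_of_real[of 0] by simp
next
  case False
  have "0 \<le> Re z" if z: "z \<in> spectrum (c *\<^sub>R x)" for z
  proof -
    have "z / of_real c \<in> spectrum x"
      using z spectrum_affine[of "of_real c" 0 "z / of_real c" x] False
      by (simp add: scaleR_scaleC)
    then have "0 \<le> Re (z / of_real c)" using assms(2) positive_cone_iff by blast
    then show ?thesis using assms(1) False by (simp add: zero_le_divide_iff)
  qed
  then show ?thesis
    using assms(2) by (simp add: positive_cone_iff star_scaleR)
qed

lemma nonneg_of_positive_of_real:
  assumes "of_real t + y \<in> positive_cone" "0 \<in> spectrum (y::'a::cstar_algebra)"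
  shows "0 \<le> t"
proof -
  have "of_real t \<in> spectrum (of_real t + y)"
    using assms(2) spectrum_affine[of 1 "of_real t" 0 y] by (simp add: of_real_eq_scaleC scaleC_one)
  then show ?thesis using assms(1) positive_cone_iff[of "of_real t + y"] by fastforce
qed

text \<open>
  A complex number that is not a nonnegative real has two square roots, both off the real line and
  hence outside the spectrum of \<open>y\<close>; so \<open>y * y - z = (y - w) * (y + w)\<close> is invertible.
\<close>

lemma positive_square:
  fixes y :: "'a::cstar_algebra"
  assumes sa: "star y = y"
  shows "y * y \<in> positive_cone"
proof -
  have sq: "star (y * y) = y * y" by (simp add: star_mult sa)
  have "0 \<le> Re z" if z: "z \<in> spectrum (y * y)" for z
  proof (rule ccontr)
    assume neg: "\<not> 0 \<le> Re z"
    obtain w where w: "w * w = z" by (metis power2_csqrt power2_eq_square)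
    have "Im w \<noteq> 0"
    proof
      assume "Im w = 0"
      then have "Re z = Re w * Re w" by (simp flip: w)
      then show False using neg by simp
    qed
    then have "w \<notin> spectrum y" "- w \<notin> spectrum y"
      using spectrum_selfadjoint_real[OF sa] by fastforce+
    then have "invertible_elem ((y - w *\<^sub>C 1) * (y - (- w) *\<^sub>C 1))"
      by (intro invertible_elem_mult) (auto simp: mem_spectrum_iff)
    also have "(y - w *\<^sub>C 1) * (y - (- w) *\<^sub>C 1) = y * y - z *\<^sub>C 1"
      by (simp add: algebra_simps scaleC_simps flip: w)
    finally show False using z by (simp add: mem_spectrum_iff)
  qed
  then show ?thesis using sq by (simp add: positive_cone_iff)
qed

section \<open>Polynomials of a self-adjoint element\<close>

definition poly_at :: "'a::cstar_algebra \<Rightarrow> complex poly \<Rightarrow> 'a" where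
  "poly_at a p = fold_coeffs (\<lambda>c y. c *\<^sub>C 1 + a * y) p 0"

lemma poly_at_0 [simp]: "poly_at a 0 = 0"
  by (simp add: poly_at_def)

lemma poly_at_pCons [simp]: "poly_at a (pCons c p) = c *\<^sub>C 1 + a * poly_at a p"
  by (cases "p = 0 \<and> c = 0") (auto simp: poly_at_def)

lemma poly_at_add: "poly_at a (p + q) = poly_at a p + poly_at a q"
  by (induction p q rule: poly_induct2) (simp_all add: algebra_simps scaleC_simps)

lemma poly_at_smult: "poly_at a (smult c p) = c *\<^sub>C poly_at a p"
  by (induction p) (simp_all add: scaleC_simps)

lemma poly_at_diff: "poly_at a (p - q) = poly_at a p - poly_at a q"
proof -
  have "p - q = p + smult (- 1) q" by simp
  then have "poly_at a (p - q) = poly_at a p + (- 1) *\<^sub>C poly_at a q"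
    by (simp only: poly_at_add poly_at_smult)
  then show ?thesis by (simp add: scaleC_one)
qed

lemma poly_at_mult: "poly_at a (p * q) = poly_at a p * poly_at a q"
  by (induction p) (simp_all add: poly_at_add poly_at_smult algebra_simps scaleC_simps)

lemma poly_at_commute: "a * poly_at a p = poly_at a p * a"
  by (induction p) (simp_all add: distrib_left distrib_right scaleC_simps flip: mult.assoc)

lemma star_poly_at:
  assumes sa: "star a = a"
  shows "star (poly_at a p) = poly_at a (map_poly cnj p)"
  by (induction p)
    (simp_all add: map_poly_pCons star_add star_scaleC star_mult sa poly_at_commute)

lemma poly_at_mem_spectrum:
  assumes z: "z \<in> spectrum a"
  shows "poly p z \<in> spectrum (poly_at a p)"
proof -
  have "poly (p - [:poly p z:]) z = 0" by simp
  then obtain q where q: "p - [:poly p z:] = [:- z, 1:] * q"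
    unfolding poly_eq_0_iff_dvd by (elim dvdE)
  have "poly_at a p - poly p z *\<^sub>C 1 = poly_at a (p - [:poly p z:])"
    by (simp add: poly_at_diff)
  also have "\<dots> = (a - z *\<^sub>C 1) * poly_at a q"
    unfolding q poly_at_mult by (simp add: scaleC_one algebra_simps scaleC_simps)
  finally have eq: "poly_at a p - poly p z *\<^sub>C 1 = (a - z *\<^sub>C 1) * poly_at a q" .
  have "\<not> invertible_elem ((a - z *\<^sub>C 1) * poly_at a q)"
  proof
    assume "invertible_elem ((a - z *\<^sub>C 1) * poly_at a q)"
    then have "invertible_elem (a - z *\<^sub>C 1)"
      by (rule invertible_elem_of_commuting_factor)
        (simp add: left_diff_distrib right_diff_distrib poly_at_commute scaleC_simps)
    then show False using z by (simp add: mem_spectrum_iff)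
  qed
  then show ?thesis unfolding mem_spectrum_iff eq .
qed

text \<open>
  By the fundamental theorem of algebra, for \<open>p \<noteq> 0\<close> the element \<open>poly_at a p\<close> is up to a scalar a
  product of factors \<open>a - z\<close>, one for each root; if none of the roots lies in the spectrum, all
  factors are invertible. For \<open>p = 0\<close> every point of the spectrum is a root.
\<close>

lemma ex_root_in_spectrum:
  fixes a :: "'a::cstar_algebra"
  assumes "\<not> invertible_elem (poly_at a p)" "spectrum a \<noteq> {}"
  shows "\<exists>z\<in>spectrum a. poly p z = 0"
  using assms(1)
proof (induction "degree p" arbitrary: p)
  case 0
  then obtain c where p: "p = [:c:]" by (metis degree_eq_zeroE)
  then have "c = 0" using 0 invertible_elem_scaleC[of 1 c] by auto
  then show ?case using p assms(2) by auto
next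
  case (Suc n)
  then obtain z where "poly p z = 0"
    using fundamental_theorem_of_algebra[of p] by (auto simp: constant_degree)
  then obtain q where q: "p = [:- z, 1:] * q"
    unfolding poly_eq_0_iff_dvd by (elim dvdE)
  show ?case
  proof (cases "z \<in> spectrum a")
    case True
    then show ?thesis using \<open>poly p z = 0\<close> by blast
  next
    case False
    have "poly_at a p = (a - z *\<^sub>C 1) * poly_at a q"
      unfolding q poly_at_mult by (simp add: scaleC_one algebra_simps scaleC_simps)
    then have "\<not> invertible_elem (poly_at a q)"
      using False Suc.prems invertible_elem_mult by (auto simp: mem_spectrum_iff)
    moreover have "q \<noteq> 0" using Suc.hyps(2) q by auto
    then have "degree q = n" using Suc.hyps(2) by (simp add: q degree_mult_eq del: mult_pCons_left)
    ultimately obtain w where "w \<in> spectrum a" "poly q w = 0"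
      using Suc.hyps(1)[of q] by blast
    then show ?thesis by (intro bexI[of _ w]) (simp_all add: q)
  qed
qed

lemma spectrum_poly_at:
  assumes "spectrum a \<noteq> {}"
  shows "spectrum (poly_at a p) = poly p ` spectrum a"
proof (intro equalityI subsetI)
  fix w assume "w \<in> spectrum (poly_at a p)"
  then have "\<not> invertible_elem (poly_at a (p - [:w:]))"
    by (simp add: mem_spectrum_iff poly_at_diff)
  then obtain z where "z \<in> spectrum a" "poly (p - [:w:]) z = 0"
    using ex_root_in_spectrum[OF _ assms] by blast
  then show "w \<in> poly p ` spectrum a" by auto
qed (auto intro: poly_at_mem_spectrum)

lemma spectrum_selfadjoint_nonempty: "star a = a \<Longrightarrow> spectrum a \<noteq> {}"
  using ex_norm_in_spectrum by blast

text \<open>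
  The polynomial calculus is isometric for the supremum norm on the spectrum. The spectral radius is
  available for self-adjoint elements only, so it is applied to \<open>star (poly_at a p) * poly_at a p\<close>,
  which is the value of a polynomial equal to \<open>\<bar>p\<bar>\<^sup>2\<close> on the real spectrum.
\<close>

theorem norm_poly_at:
  fixes a :: "'a::cstar_algebra"
  assumes sa: "star a = a"
  shows "\<And>z. z \<in> spectrum a \<Longrightarrow> cmod (poly p z) \<le> norm (poly_at a p)"
    and "\<exists>z\<in>spectrum a. cmod (poly p z) = norm (poly_at a p)"
proof -
  show "cmod (poly p z) \<le> norm (poly_at a p)" if "z \<in> spectrum a" for z
    by (rule norm_ge_of_mem_spectrum[OF poly_at_mem_spectrum[OF that]])
  let ?q = "map_poly cnj p * p"
  have q: "poly_at a ?q = star (poly_at a p) * poly_at a p"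
    by (simp add: poly_at_mult star_poly_at sa)
  then have "star (poly_at a ?q) = poly_at a ?q" by (simp add: star_mult star_star)
  then obtain w where "w \<in> spectrum (poly_at a ?q)" and w: "cmod w = norm (poly_at a ?q)"
    using ex_norm_in_spectrum by blast
  then obtain z where z: "z \<in> spectrum a" "w = poly ?q z"
    using spectrum_poly_at[OF spectrum_selfadjoint_nonempty[OF sa]] by blast
  have "cnj z = z" using spectrum_selfadjoint_real[OF sa z(1)] by (simp add: complex_eq_iff)
  then have "poly (map_poly cnj p) z = cnj (poly p z)"
    using poly_cnj[of p z] by simp
  then have "(cmod (poly p z))\<^sup>2 = cmod w" unfolding z(2) by (simp add: norm_mult power2_eq_square)
  also have "\<dots> = (norm (poly_at a p))\<^sup>2" unfolding w q by (rule cstar_identity)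
  finally show "\<exists>z\<in>spectrum a. cmod (poly p z) = norm (poly_at a p)"
    using z(1) by (intro bexI[of _ z]) auto
qed

section \<open>The continuous functional calculus\<close>

text \<open>
  Complex polynomials are dense only because \<open>S\<close> is real: the real and imaginary parts of \<open>f\<close> are
  functions of the real coordinate, to which the real Weierstrass theorem applies.
\<close>

lemma poly_approximation_on_real_set:
  fixes f :: "complex \<Rightarrow> complex"
  assumes S: "compact S" "\<And>z. z \<in> S \<Longrightarrow> Im z = 0" and f: "continuous_on S f" and "0 < e"
  shows "\<exists>p. \<forall>z\<in>S. cmod (f z - poly p z) < e"
proof -
  have R: "compact (Re ` S)" by (intro compact_continuous_image S(1) continuous_intros)
  have on: "complex_of_real (Re z) = z" if "z \<in> S" for z
    using S(2)[OF that] by (simp add: complex_eq_iff)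
  have real_case: "\<exists>p. \<forall>z\<in>S. cmod (of_real (h z) - poly p z) < e / 2"
    if h: "continuous_on S h" for h :: "complex \<Rightarrow> real"
  proof -
    have "continuous_on (Re ` S) (\<lambda>r. h (of_real r))"
      by (rule continuous_on_compose2[OF h]) (auto intro!: continuous_intros simp: on)
    then obtain g where g: "real_polynomial_function g"
      and le: "\<And>r. r \<in> Re ` S \<Longrightarrow> \<bar>h (of_real r) - g r\<bar> < e / 2"
      using Stone_Weierstrass_real_polynomial_function[OF R _ half_gt_zero[OF \<open>0 < e\<close>]] by blast
    obtain c n where c: "g = (\<lambda>x. \<Sum>i\<le>n. c i * x ^ i)"
      using g real_polynomial_function_iff_sum by blast
    let ?p = "\<Sum>i\<le>n. monom (complex_of_real (c i)) i"
    have "cmod (of_real (h z) - poly ?p z) < e / 2" if z: "z \<in> S" for z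
    proof -
      have "poly ?p (of_real (Re z)) = of_real (g (Re z))"
        by (simp add: poly_sum poly_monom c)
      then have "poly ?p z = of_real (g (Re z))" by (simp only: on[OF z])
      moreover have "\<bar>h z - g (Re z)\<bar> < e / 2" using le[of "Re z"] z on[OF z] by simp
      ultimately show ?thesis by (simp flip: of_real_diff)
    qed
    then show ?thesis by blast
  qed
  have "continuous_on S (\<lambda>z. Re (f z))" "continuous_on S (\<lambda>z. Im (f z))"
    by (intro continuous_intros f)+
  then obtain p q where
    p: "\<forall>z\<in>S. cmod (of_real (Re (f z)) - poly p z) < e / 2" and
    q: "\<forall>z\<in>S. cmod (of_real (Im (f z)) - poly q z) < e / 2"
    using real_case by metis
  have "cmod (f z - poly (p + smult \<i> q) z) < e" if z: "z \<in> S" for z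
  proof -
    have "f z - poly (p + smult \<i> q) z
        = (of_real (Re (f z)) - poly p z) + \<i> * (of_real (Im (f z)) - poly q z)"
      by (subst complex_eq[of "f z"]) (simp add: algebra_simps)
    also have "cmod \<dots> \<le> cmod (of_real (Re (f z)) - poly p z) + cmod (of_real (Im (f z)) - poly q z)"
      by (rule order_trans[OF norm_triangle_ineq]) (simp add: norm_mult)
    also have "\<dots> < e" using bspec[OF p z] bspec[OF q z] by simp
    finally show ?thesis .
  qed
  then show ?thesis by blast
qed

text \<open>
  The calculus as a relation, so that the algebraic laws follow from limit laws before existence
  and uniqueness of the value are known.
\<close>

definition calculus_value :: "'a::cstar_algebra \<Rightarrow> (complex \<Rightarrow> complex) \<Rightarrow> 'a \<Rightarrow> bool" where
  "calculus_value a f y \<longleftrightarrow>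
     (\<exists>p. uniform_limit (spectrum a) (\<lambda>n. poly (p n)) f sequentially \<and>
          (\<lambda>n. poly_at a (p n)) \<longlonglongrightarrow> y)"

lemma calculus_valueI:
  "uniform_limit (spectrum a) (\<lambda>n. poly (p n)) f sequentially \<Longrightarrow>
    (\<lambda>n. poly_at a (p n)) \<longlonglongrightarrow> y \<Longrightarrow> calculus_value a f y"
  by (auto simp: calculus_value_def)

lemma calculus_value_poly: "calculus_value a (poly p) (poly_at a p)"
  unfolding calculus_value_def by (intro exI[of _ "\<lambda>n. p"]) (simp add: uniform_limit_iff)

lemma calculus_value_add:
  assumes "calculus_value a f y" "calculus_value a g w"
  shows "calculus_value a (\<lambda>z. f z + g z) (y + w)"
proof -
  from assms obtain p q where
    "uniform_limit (spectrum a) (\<lambda>n. poly (p n)) f sequentially" "(\<lambda>n. poly_at a (p n)) \<longlonglongrightarrow> y"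
    "uniform_limit (spectrum a) (\<lambda>n. poly (q n)) g sequentially" "(\<lambda>n. poly_at a (q n)) \<longlonglongrightarrow> w"
    by (auto simp: calculus_value_def)
  moreover have "poly (p n + q n) = (\<lambda>z. poly (p n) z + poly (q n) z)" for n
    by (simp add: fun_eq_iff)
  ultimately have "uniform_limit (spectrum a) (\<lambda>n. poly (p n + q n)) (\<lambda>z. f z + g z) sequentially"
    "(\<lambda>n. poly_at a (p n + q n)) \<longlonglongrightarrow> y + w"
    by (simp_all add: poly_at_add uniform_limit_add tendsto_add)
  then show ?thesis by (rule calculus_valueI)
qed

lemma calculus_value_diff:
  assumes "calculus_value a f y" "calculus_value a g w"
  shows "calculus_value a (\<lambda>z. f z - g z) (y - w)"
proof -
  from assms obtain p q where
    "uniform_limit (spectrum a) (\<lambda>n. poly (p n)) f sequentially" "(\<lambda>n. poly_at a (p n)) \<longlonglongrightarrow> y"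
    "uniform_limit (spectrum a) (\<lambda>n. poly (q n)) g sequentially" "(\<lambda>n. poly_at a (q n)) \<longlonglongrightarrow> w"
    by (auto simp: calculus_value_def)
  moreover have "poly (p n - q n) = (\<lambda>z. poly (p n) z - poly (q n) z)" for n
    by (simp add: fun_eq_iff)
  ultimately have "uniform_limit (spectrum a) (\<lambda>n. poly (p n - q n)) (\<lambda>z. f z - g z) sequentially"
    "(\<lambda>n. poly_at a (p n - q n)) \<longlonglongrightarrow> y - w"
    by (simp_all add: poly_at_diff uniform_limit_minus tendsto_diff)
  then show ?thesis by (rule calculus_valueI)
qed

lemma calculus_value_mult:
  assumes "calculus_value a f y" "calculus_value a g w"
    and "continuous_on (spectrum a) f" "continuous_on (spectrum a) g"
  shows "calculus_value a (\<lambda>z. f z * g z) (y * w)"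
proof -
  from assms obtain p q where
    "uniform_limit (spectrum a) (\<lambda>n. poly (p n)) f sequentially" "(\<lambda>n. poly_at a (p n)) \<longlonglongrightarrow> y"
    "uniform_limit (spectrum a) (\<lambda>n. poly (q n)) g sequentially" "(\<lambda>n. poly_at a (q n)) \<longlonglongrightarrow> w"
    by (auto simp: calculus_value_def)
  moreover have "bounded (f ` spectrum a)" "bounded (g ` spectrum a)"
    using assms(3,4) by (auto intro: compact_imp_bounded compact_continuous_image compact_spectrum)
  moreover have "poly (p n * q n) = (\<lambda>z. poly (p n) z * poly (q n) z)" for n
    by (simp add: fun_eq_iff)
  ultimately have "uniform_limit (spectrum a) (\<lambda>n. poly (p n * q n)) (\<lambda>z. f z * g z) sequentially"
    "(\<lambda>n. poly_at a (p n * q n)) \<longlonglongrightarrow> y * w"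
    by (simp_all add: poly_at_mult tendsto_mult uniform_lim_mult)
  then show ?thesis by (rule calculus_valueI)
qed

lemma bounded_linear_star: "bounded_linear (star :: 'a::cstar_algebra \<Rightarrow> 'a)"
  by (rule bounded_linear_intro[where K = 1]) (auto simp: star_add star_scaleR)

lemma calculus_value_cnj:
  assumes sa: "star a = a" and f: "calculus_value a f y"
  shows "calculus_value a (\<lambda>z. cnj (f z)) (star y)"
proof -
  from f obtain p where
    p: "uniform_limit (spectrum a) (\<lambda>n. poly (p n)) f sequentially" "(\<lambda>n. poly_at a (p n)) \<longlonglongrightarrow> y"
    by (auto simp: calculus_value_def)
  have cnj: "poly (map_poly cnj q) z = cnj (poly q z)" if "z \<in> spectrum a" for q z
  proof -
    have "cnj z = z" using spectrum_selfadjoint_real[OF sa that] by (simp add: complex_eq_iff)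
    then show ?thesis using poly_cnj[of q z] by simp
  qed
  have "uniform_limit (spectrum a) (\<lambda>n z. cnj (poly (p n) z)) (\<lambda>z. cnj (f z)) sequentially"
    by (rule bounded_linear.uniform_limit[OF bounded_linear_cnj p(1)])
  also have "?this \<longleftrightarrow>
      uniform_limit (spectrum a) (\<lambda>n. poly (map_poly cnj (p n))) (\<lambda>z. cnj (f z)) sequentially"
    by (rule uniform_limit_cong') (simp_all only: cnj)
  finally have "uniform_limit (spectrum a) (\<lambda>n. poly (map_poly cnj (p n))) (\<lambda>z. cnj (f z)) sequentially" .
  moreover have "(\<lambda>n. poly_at a (map_poly cnj (p n))) \<longlonglongrightarrow> star y"
    using bounded_linear.tendsto[OF bounded_linear_star p(2)] by (simp add: star_poly_at[OF sa])
  ultimately show ?thesis by (rule calculus_valueI)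
qed

text \<open>
  Passage to the limit in \<open>norm_poly_at\<close>. As the norm of \<open>y\<close> depends on \<open>f\<close> alone, this also
  yields uniqueness: the difference of two values is a value of the zero function.
\<close>

lemma norm_calculus_value:
  assumes sa: "star a = a" and f: "calculus_value a f y"
  shows "norm y = (SUP z\<in>spectrum a. cmod (f z))"
proof -
  from f obtain p where
    p: "uniform_limit (spectrum a) (\<lambda>n. poly (p n)) f sequentially" "(\<lambda>n. poly_at a (p n)) \<longlonglongrightarrow> y"
    by (auto simp: calculus_value_def)
  have nl: "(\<lambda>n. norm (poly_at a (p n))) \<longlonglongrightarrow> norm y" by (intro tendsto_norm p(2))
  have le: "cmod (f z) \<le> norm y" if z: "z \<in> spectrum a" for z
    by (rule LIMSEQ_le[OF tendsto_norm[OF tendsto_uniform_limitI[OF p(1) z]] nl])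
      (use norm_poly_at(1)[OF sa z] in blast)
  then have bdd: "bdd_above ((\<lambda>z. cmod (f z)) ` spectrum a)" by (intro bdd_aboveI2)
  show ?thesis
  proof (rule antisym)
    show "(SUP z\<in>spectrum a. cmod (f z)) \<le> norm y"
      by (rule cSUP_least[OF spectrum_selfadjoint_nonempty[OF sa] le])
    show "norm y \<le> (SUP z\<in>spectrum a. cmod (f z))"
    proof (rule field_le_epsilon)
      fix e :: real assume "0 < e"
      then have "\<forall>\<^sub>F n in sequentially. \<forall>z\<in>spectrum a. dist (poly (p n) z) (f z) < e"
        using p(1) by (auto simp: uniform_limit_iff)
      then have "\<forall>\<^sub>F n in sequentially. norm (poly_at a (p n)) \<le> (SUP z\<in>spectrum a. cmod (f z)) + e"
      proof eventually_elim
        case (elim n)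
        obtain z where z: "z \<in> spectrum a" "cmod (poly (p n) z) = norm (poly_at a (p n))"
          using norm_poly_at(2)[OF sa] by blast
        have "cmod (poly (p n) z) \<le> cmod (f z) + dist (poly (p n) z) (f z)"
          unfolding dist_norm using norm_triangle_sub[of "poly (p n) z" "f z"] by simp
        then show ?case using elim z cSUP_upper[OF z(1) bdd] by fastforce
      qed
      then show "norm y \<le> (SUP z\<in>spectrum a. cmod (f z)) + e"
        by (rule tendsto_upperbound[OF nl]) simp
    qed
  qed
qed

lemma calculus_value_unique:
  assumes sa: "star a = a" and "calculus_value a f y" "calculus_value a f w"
  shows "y = w"
proof -
  have "calculus_value a (\<lambda>z. f z - f z) (y - w)" by (rule calculus_value_diff[OF assms(2,3)])
  from norm_calculus_value[OF sa this] show ?thesis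
    using spectrum_selfadjoint_nonempty[OF sa] by simp
qed

lemma calculus_value_exists:
  assumes sa: "star a = a" and f: "continuous_on (spectrum a) f"
  shows "\<exists>y. calculus_value a f y"
proof -
  have "\<forall>n. \<exists>p. \<forall>z\<in>spectrum a. cmod (f z - poly p z) < inverse (real (Suc n))"
    using poly_approximation_on_real_set[OF compact_spectrum spectrum_selfadjoint_real[OF sa] f]
    by simp
  then obtain p where p: "\<And>n z. z \<in> spectrum a \<Longrightarrow> cmod (f z - poly (p n) z) < inverse (real (Suc n))"
    by metis
  have ul: "uniform_limit (spectrum a) (\<lambda>n. poly (p n)) f sequentially"
  proof (rule uniform_limitI)
    fix e :: real assume "0 < e"
    then obtain N where N: "inverse (real (Suc N)) < e" using reals_Archimedean by blast
    have "dist (poly (p n) z) (f z) < e" if "N \<le> n" "z \<in> spectrum a" for n z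
    proof -
      have "inverse (real (Suc n)) \<le> inverse (real (Suc N))" using that(1) by (simp add: le_imp_inverse_le)
      then show ?thesis using p[OF that(2), of n] N unfolding dist_norm norm_minus_commute[of "poly (p n) z"] by linarith
    qed
    then show "\<forall>\<^sub>F n in sequentially. \<forall>z\<in>spectrum a. dist (poly (p n) z) (f z) < e"
      by (auto simp: eventually_sequentially)
  qed
  have "Cauchy (\<lambda>n. poly_at a (p n))"
  proof (rule CauchyI)
    fix e :: real assume "0 < e"
    then have "\<forall>\<^sub>F n in sequentially. \<forall>z\<in>spectrum a. dist (poly (p n) z) (f z) < e / 2"
      using ul half_gt_zero unfolding uniform_limit_iff by blast
    then obtain N where N: "\<And>n z. N \<le> n \<Longrightarrow> z \<in> spectrum a \<Longrightarrow> dist (poly (p n) z) (f z) < e / 2"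
      by (auto simp: eventually_sequentially)
    have "norm (poly_at a (p m) - poly_at a (p n)) < e" if "N \<le> m" "N \<le> n" for m n
    proof -
      obtain z where z: "z \<in> spectrum a" "cmod (poly (p m - p n) z) = norm (poly_at a (p m - p n))"
        using norm_poly_at(2)[OF sa] by blast
      have "dist (poly (p m) z) (poly (p n) z) < e"
        by (rule dist_triangle_half_l[OF N[OF that(1) z(1)] N[OF that(2) z(1)]])
      then show ?thesis using z(2) by (simp add: dist_norm poly_at_diff)
    qed
    then show "\<exists>M. \<forall>m\<ge>M. \<forall>n\<ge>M. norm (poly_at a (p m) - poly_at a (p n)) < e" by blast
  qed
  then show ?thesis
    using ul by (auto simp: calculus_value_def Cauchy_convergent_iff convergent_def)
qed

theorem functional_calculus_exists:
  assumes sa: "star a = a"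
  shows "\<exists>\<Phi>. is_functional_calculus a \<Phi>"
proof
  define \<Phi> where "\<Phi> = (\<lambda>f. THE y. calculus_value a f y)"
  have eq: "\<Phi> f = y" if "calculus_value a f y" for f y
    unfolding \<Phi>_def using that calculus_value_unique[OF sa] by blast
  have val: "calculus_value a f (\<Phi> f)" if "continuous_on (spectrum a) f" for f
    using calculus_value_exists[OF sa that] eq by metis
  have const: "calculus_value a (\<lambda>z. c) (c *\<^sub>C 1)" for c
  proof -
    have "poly [:c:] = (\<lambda>z. c)" by (simp add: fun_eq_iff)
    then show ?thesis using calculus_value_poly[of a "[:c:]"] by simp
  qed
  have ident: "calculus_value a (\<lambda>z. z) a"
  proof -
    have "poly [:0, 1:] = (\<lambda>z::complex. z)" by (simp add: fun_eq_iff)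
    then show ?thesis using calculus_value_poly[of a "[:0, 1:]"] by (simp add: scaleC_one)
  qed
  show "is_functional_calculus a \<Phi>"
    unfolding is_functional_calculus_def
  proof (intro conjI allI impI)
    show "\<Phi> (\<lambda>z. 1) = 1" using eq[OF const[of 1]] by (simp add: scaleC_one)
    show "\<Phi> (\<lambda>z. z) = a" by (rule eq[OF ident])
  next
    fix f :: "complex \<Rightarrow> complex" and c assume f: "continuous_on (spectrum a) f"
    show "\<Phi> (\<lambda>z. c * f z) = c *\<^sub>C \<Phi> f"
      using eq[OF calculus_value_mult[OF const val[OF f] continuous_on_const f]]
      by (simp add: scaleC_simps)
    show "\<Phi> (\<lambda>z. cnj (f z)) = star (\<Phi> f)" by (rule eq[OF calculus_value_cnj[OF sa val[OF f]]])
    show "norm (\<Phi> f) = (SUP z\<in>spectrum a. cmod (f z))" by (rule norm_calculus_value[OF sa val[OF f]])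
  next
    fix f g :: "complex \<Rightarrow> complex" assume f: "continuous_on (spectrum a) f" and g: "continuous_on (spectrum a) g"
    show "\<Phi> (\<lambda>z. f z + g z) = \<Phi> f + \<Phi> g" by (rule eq[OF calculus_value_add[OF val[OF f] val[OF g]]])
    show "\<Phi> (\<lambda>z. f z * g z) = \<Phi> f * \<Phi> g"
      by (rule eq[OF calculus_value_mult[OF val[OF f] val[OF g] f g]])
  qed
qed

context
  fixes a :: "'a::cstar_algebra"
  assumes sa: "star a = a"
begin

lemma is_functional_calculus_cfc: "is_functional_calculus a (cfc a)"
  unfolding cfc_def by (rule someI_ex[OF functional_calculus_exists[OF sa]])

lemma cfc_id: "cfc a (\<lambda>z. z) = a"
  using is_functional_calculus_cfc by (simp add: is_functional_calculus_def)

lemma cfc_scaleC: "continuous_on (spectrum a) f \<Longrightarrow> cfc a (\<lambda>z. c * f z) = c *\<^sub>C cfc a f"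
  and cfc_cnj: "continuous_on (spectrum a) f \<Longrightarrow> cfc a (\<lambda>z. cnj (f z)) = star (cfc a f)"
  and norm_cfc: "continuous_on (spectrum a) f \<Longrightarrow> norm (cfc a f) = (SUP z\<in>spectrum a. cmod (f z))"
  using is_functional_calculus_cfc unfolding is_functional_calculus_def by blast+

lemma cfc_add: "continuous_on (spectrum a) f \<Longrightarrow> continuous_on (spectrum a) g \<Longrightarrow>
    cfc a (\<lambda>z. f z + g z) = cfc a f + cfc a g"
  and cfc_mult: "continuous_on (spectrum a) f \<Longrightarrow> continuous_on (spectrum a) g \<Longrightarrow>
    cfc a (\<lambda>z. f z * g z) = cfc a f * cfc a g"
  using is_functional_calculus_cfc unfolding is_functional_calculus_def by blast+

lemma cfc_const: "cfc a (\<lambda>z. c) = c *\<^sub>C 1"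
proof -
  have "cfc a (\<lambda>z. 1) = 1" using is_functional_calculus_cfc by (simp add: is_functional_calculus_def)
  then show ?thesis using cfc_scaleC[of "\<lambda>z. 1" c] by simp
qed

lemma cfc_cong:
  assumes f: "continuous_on (spectrum a) f" and eq: "\<And>z. z \<in> spectrum a \<Longrightarrow> f z = g z"
  shows "cfc a f = cfc a g"
proof -
  have g: "continuous_on (spectrum a) g" using f eq by (rule continuous_on_eq)
  then have mg: "continuous_on (spectrum a) (\<lambda>z. (- 1) * g z)" by (intro continuous_intros)
  have "norm (cfc a (\<lambda>z. f z + (- 1) * g z)) = (SUP z\<in>spectrum a. cmod (f z + (- 1) * g z))"
    by (intro norm_cfc continuous_on_add f mg)
  also have "\<dots> = 0" using spectrum_selfadjoint_nonempty[OF sa] by (simp add: eq cong: SUP_cong_simp)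
  finally show ?thesis by (simp only: cfc_add[OF f mg] cfc_scaleC[OF g]) (simp add: scaleC_one)
qed

text \<open>
  The value is the square of the self-adjoint element \<open>cfc a (\<lambda>z. sqrt (h z))\<close>.
\<close>

lemma cfc_positive:
  fixes h :: "complex \<Rightarrow> real"
  assumes h: "continuous_on (spectrum a) h" and nonneg: "\<And>z. z \<in> spectrum a \<Longrightarrow> 0 \<le> h z"
  shows "cfc a (\<lambda>z. of_real (h z)) \<in> positive_cone"
proof -
  let ?s = "\<lambda>z. complex_of_real (sqrt (h z))"
  have s: "continuous_on (spectrum a) ?s" by (intro continuous_intros h)
  have "star (cfc a ?s) = cfc a ?s" using cfc_cnj[OF s] by simp
  then have "cfc a ?s * cfc a ?s \<in> positive_cone" by (rule positive_square)
  also have "cfc a ?s * cfc a ?s = cfc a (\<lambda>z. ?s z * ?s z)" by (rule cfc_mult[OF s s, symmetric])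
  also have "\<dots> = cfc a (\<lambda>z. of_real (h z))"
    by (rule cfc_cong[OF continuous_on_mult[OF s s]]) (use nonneg in \<open>simp flip: of_real_mult\<close>)
  finally show ?thesis .
qed

lemma cfc_bounds:
  fixes h :: "complex \<Rightarrow> real"
  assumes h: "continuous_on (spectrum a) h"
    and bounds: "\<And>z. z \<in> spectrum a \<Longrightarrow> c \<le> h z \<and> h z \<le> d"
  shows "cfc a (\<lambda>z. of_real (h z)) - of_real c \<in> positive_cone"
    and "of_real d - cfc a (\<lambda>z. of_real (h z)) \<in> positive_cone"
proof -
  have oh: "continuous_on (spectrum a) (\<lambda>z. complex_of_real (h z))" by (intro continuous_intros h)
  have mh: "continuous_on (spectrum a) (\<lambda>z. (- 1) * complex_of_real (h z))"
    by (intro continuous_on_mult continuous_on_const oh)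
  have "cfc a (\<lambda>z. of_real (h z)) - of_real c = cfc a (\<lambda>z. of_real (h z) + of_real (- c))"
    by (simp only: cfc_add[OF oh continuous_on_const] cfc_const) (simp add: of_real_eq_scaleC)
  also have "\<dots> = cfc a (\<lambda>z. of_real (h z - c))" by simp
  also have "\<dots> \<in> positive_cone"
    by (rule cfc_positive) (use bounds h in \<open>auto intro!: continuous_intros\<close>)
  finally show "cfc a (\<lambda>z. of_real (h z)) - of_real c \<in> positive_cone" .
  have "of_real d - cfc a (\<lambda>z. of_real (h z)) = cfc a (\<lambda>z. of_real d + (- 1) * of_real (h z))"
    by (simp only: cfc_add[OF continuous_on_const mh] cfc_const cfc_scaleC[OF oh])
      (simp add: of_real_eq_scaleC scaleC_one)
  also have "\<dots> = cfc a (\<lambda>z. of_real (d - h z))" by simp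
  also have "\<dots> \<in> positive_cone"
    by (rule cfc_positive) (use bounds h in \<open>auto intro!: continuous_intros\<close>)
  finally show "of_real d - cfc a (\<lambda>z. of_real (h z)) \<in> positive_cone" .
qed

end

lemma cstar_power_one:
  assumes "a \<in> positive_cone"
  shows "cstar_power a 1 = a"
proof -
  have sa: "star a = a" by (rule star_of_positive[OF assms])
  have "z = complex_of_real (Re z powr 1)" if "z \<in> spectrum a" for z
    using that assms positive_cone_iff[of a] spectrum_selfadjoint_real[OF sa that]
    by (auto simp: complex_eq_iff)
  then have "cfc a (\<lambda>z. z) = cfc a (\<lambda>z. complex_of_real (Re z powr 1))"
    by (intro cfc_cong[OF sa]) auto
  then show ?thesis by (simp add: cstar_power_def cfc_id[OF sa])
qed

text \<open>
  The bounds are the extreme values of \<open>x \<mapsto> x powr \<alpha>\<close> on the spectrum, which is compact and contains only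
  positive numbers. The lower one is positive because it is attained.
\<close>

lemma cstar_power_bounds:
  fixes a :: "'a::cstar_algebra"
  assumes pos: "a \<in> positive_cone" and inv: "invertible_elem a"
  shows "\<exists>c>0. \<exists>d. cstar_power a \<alpha> - of_real c \<in> positive_cone \<and>
    of_real d - cstar_power a \<alpha> \<in> positive_cone"
proof (cases "\<alpha> = 0")
  case True
  then show ?thesis
    using positive_of_real[of 0, where ?'a = 'a] by (intro exI[of _ 1] conjI) (auto simp: cstar_power_def)
next
  case False
  have sa: "star a = a" by (rule star_of_positive[OF pos])
  have ne: "spectrum a \<noteq> {}" by (rule spectrum_selfadjoint_nonempty[OF sa])
  have gt: "0 < Re z" if z: "z \<in> spectrum a" for z
  proof -
    have "z \<noteq> 0" using z inv by (auto simp: mem_spectrum_iff)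
    then show ?thesis
      using z pos positive_cone_iff[of a] spectrum_selfadjoint_real[OF sa z]
      by (fastforce simp: complex_eq_iff less_le)
  qed
  have h: "continuous_on (spectrum a) (\<lambda>z. Re z powr \<alpha>)"
    by (intro continuous_intros) (use gt in force)
  obtain u where u: "u \<in> spectrum a" "\<And>z. z \<in> spectrum a \<Longrightarrow> Re u powr \<alpha> \<le> Re z powr \<alpha>"
    using continuous_attains_inf[OF compact_spectrum ne h] by blast
  obtain v where v: "\<And>z. z \<in> spectrum a \<Longrightarrow> Re z powr \<alpha> \<le> Re v powr \<alpha>"
    using continuous_attains_sup[OF compact_spectrum ne h] by blast
  have "0 < Re u powr \<alpha>" using gt[OF u(1)] by simp
  moreover have "cstar_power a \<alpha> - of_real (Re u powr \<alpha>) \<in> positive_cone"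
    "of_real (Re v powr \<alpha>) - cstar_power a \<alpha> \<in> positive_cone"
    using cfc_bounds[OF sa h, of "Re u powr \<alpha>" "Re v powr \<alpha>"] u(2) v False
    by (simp_all add: cstar_power_def)
  ultimately show ?thesis by blast
qed

section \<open>Positive functionals\<close>

definition herm_part :: "'a::cstar_algebra \<Rightarrow> 'a" where
  "herm_part x = (1 / 2) *\<^sub>R (x + star x)"

lemma herm_part_add: "herm_part (x + y) = herm_part x + herm_part y"
  by (simp add: herm_part_def star_add algebra_simps)

lemma herm_part_scaleR: "herm_part (c *\<^sub>R x) = c *\<^sub>R herm_part x"
  by (simp add: herm_part_def star_scaleR algebra_simps)

lemma star_herm_part [simp]: "star (herm_part x) = herm_part x"
  by (simp add: herm_part_def star_scaleR star_add star_star add.commute)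

lemma herm_part_of_selfadjoint: "star x = x \<Longrightarrow> herm_part x = x"
  by (simp add: herm_part_def flip: scaleR_2)

lemma herm_part_of_skew: "star x = - x \<Longrightarrow> herm_part x = 0"
  by (simp add: herm_part_def)

lemma norm_herm_part_le: "norm (herm_part x) \<le> norm x"
  using norm_triangle_ineq[of x "star x"] by (simp add: herm_part_def)

lemma positive_zero [simp]: "0 \<in> positive_cone"
  using positive_of_real[of 0] by simp

text \<open>
  A complex-linear functional is determined by its real part \<open>F\<close> through \<open>\<phi> x = F x - \<i> F (\<i> x)\<close>. Vanishing on
  skew elements makes \<open>\<phi>\<close> real on self-adjoint ones. The hypotheses are one-sided bounds, the form in which
  \<open>cone_imp_linear_minorant\<close> delivers \<open>F\<close>.
\<close>

lemma positive_functional_of_real_part: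
  fixes F :: "'a::cstar_algebra \<Rightarrow> real"
  assumes lin: "linear F" and bdd: "\<And>x. F x \<le> K * norm x"
    and skew: "\<And>x. star x = - x \<Longrightarrow> F x \<le> 0"
    and neg: "\<And>u. u \<in> positive_cone \<Longrightarrow> F (- u) \<le> 0"
  shows "\<exists>\<phi>\<in>dual_pos. \<forall>x. Re (blinfun_apply \<phi> x) = F x"
proof -
  note F = linear_add[OF lin] linear_scale[OF lin] linear_neg[OF lin]
  have abs: "\<bar>F x\<bar> \<le> K * norm x" for x
    using bdd[of x] bdd[of "- x"] by (simp add: F)
  let ?f = "\<lambda>x. Complex (F x) (- F (\<i> *\<^sub>C x))"
  have "bounded_linear ?f"
  proof (rule bounded_linear_intro[where K = "2 * K"])
    fix x :: 'a
    have "cmod (?f x) \<le> \<bar>F x\<bar> + \<bar>F (\<i> *\<^sub>C x)\<bar>" using cmod_le[of "?f x"] by simp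
    also have "\<dots> \<le> norm x * (2 * K)" using abs[of x] abs[of "\<i> *\<^sub>C x"] by (simp add: norm_scaleC algebra_simps)
    finally show "cmod (?f x) \<le> norm x * (2 * K)" .
  qed (simp_all add: complex_eq_iff F scaleC_simps scaleC_scaleR_commute)
  then have app: "blinfun_apply (Blinfun ?f) = ?f" by (rule bounded_linear_Blinfun_apply)
  have split: "F (c *\<^sub>C x) = Re c * F x + Im c * F (\<i> *\<^sub>C x)" for c x
  proof -
    have "c *\<^sub>C x = Re c *\<^sub>R x + Im c *\<^sub>R (\<i> *\<^sub>C x)"
      by (subst complex_eq[of c]) (simp add: scaleC_simps scaleR_scaleC mult.commute)
    then show ?thesis by (simp add: F)
  qed
  have "Blinfun ?f \<in> dual"
  proof -
    have "?f (c *\<^sub>C x) = c * ?f x" for c x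
      using split[of c x] split[of "\<i> * c" x] by (simp add: complex_eq_iff scaleC_simps)
    then show ?thesis by (simp add: dual_def app)
  qed
  moreover have "?f u \<in> \<real>\<^sub>\<ge>\<^sub>0" if u: "u \<in> positive_cone" for u
  proof -
    have "star (\<i> *\<^sub>C u) = - (\<i> *\<^sub>C u)" by (simp add: star_scaleC star_of_positive[OF u])
    then have "F (\<i> *\<^sub>C u) = 0"
      using skew[of "\<i> *\<^sub>C u"] skew[of "- (\<i> *\<^sub>C u)"] by (simp add: F)
    then show ?thesis using neg[OF u] by (simp add: F complex_nonneg_Reals_iff)
  qed
  ultimately have "Blinfun ?f \<in> dual_pos" by (simp add: dual_pos_def app)
  then show ?thesis by (intro bexI[of _ "Blinfun ?f"]) (simp add: app)
qed

text \<open>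
  The demands \<open>F x \<le> t\<close> whenever \<open>x \<le> t \<sqdot> 1 + s \<sqdot> a\<close> for some real \<open>s\<close> force \<open>F a = 0\<close>, \<open>F 1 = 1\<close> and
  positivity. They are consistent because \<open>0 \<le> t \<sqdot> 1 + s \<sqdot> a\<close> implies \<open>t \<ge> 0\<close> when \<open>0\<close> is in the
  spectrum of \<open>a\<close>.
\<close>

theorem ex_positive_functional_vanishing:
  fixes a :: "'a::cstar_algebra"
  assumes sa: "star a = a" and zero: "0 \<in> spectrum a"
  shows "\<exists>\<phi>\<in>dual_pos. \<phi> \<noteq> 0 \<and> Re (blinfun_apply \<phi> a) = 0"
proof -
  define W where "W = {(x, t). \<exists>s. of_real t + s *\<^sub>R a - herm_part x \<in> positive_cone}"
  have W: "(x, t) \<in> W" if "of_real t + s *\<^sub>R a - herm_part x \<in> positive_cone" for x t s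
    using that by (auto simp: W_def)
  obtain F where F: "linear F" "\<And>x t. (x, t) \<in> W \<Longrightarrow> F x \<le> t"
  proof (rule cone_imp_linear_minorant[of W])
    fix x y t u assume "(x, t) \<in> W" "(y, u) \<in> W"
    then obtain s r where "of_real t + s *\<^sub>R a - herm_part x \<in> positive_cone"
      "of_real u + r *\<^sub>R a - herm_part y \<in> positive_cone" by (auto simp: W_def)
    then have "(of_real t + s *\<^sub>R a - herm_part x) + (of_real u + r *\<^sub>R a - herm_part y) \<in> positive_cone"
      by (rule positive_add)
    then show "(x + y, t + u) \<in> W"
      by (intro W[of _ "s + r"]) (simp add: herm_part_add algebra_simps)
  next
    fix c t :: real and x assume "0 < c" "(x, t) \<in> W"
    then obtain s where "of_real t + s *\<^sub>R a - herm_part x \<in> positive_cone" by (auto simp: W_def)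
    then have "c *\<^sub>R (of_real t + s *\<^sub>R a - herm_part x) \<in> positive_cone"
      using \<open>0 < c\<close> by (intro positive_scaleR) auto
    then show "(c *\<^sub>R x, c * t) \<in> W"
      by (intro W[of _ "c * s"]) (simp add: herm_part_scaleR of_real_def algebra_simps)
  next
    fix x show "\<exists>t. (x, t) \<in> W"
      by (rule exI, rule W[of "norm (herm_part x)" 0]) (simp add: norm_minus_selfadjoint_positive)
  next
    fix t assume "(0, t) \<in> W"
    then obtain s where s: "of_real t + s *\<^sub>R a \<in> positive_cone"
      by (auto simp: W_def herm_part_def)
    have "0 \<in> spectrum (s *\<^sub>R a)"
    proof (cases "s = 0")
      case True
      then show ?thesis by (simp add: mem_spectrum_iff)
    next
      case False
      then show ?thesis
        using zero spectrum_affine[of "of_real s" 0 0 a] by (simp add: scaleR_scaleC)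
    qed
    then show "0 \<le> t" using nonneg_of_positive_of_real[OF s] by simp
  qed (rule that)
  have "\<exists>\<phi>\<in>dual_pos. \<forall>x. Re (blinfun_apply \<phi> x) = F x"
  proof (rule positive_functional_of_real_part[OF F(1), of 1])
    fix x :: 'a
    have "F x \<le> norm (herm_part x)"
      by (rule F(2), rule W[of _ 0]) (simp add: norm_minus_selfadjoint_positive)
    then show "F x \<le> 1 * norm x" using norm_herm_part_le[of x] by simp
  next
    fix x :: 'a assume "star x = - x"
    then show "F x \<le> 0" by (intro F(2) W[of _ 0]) (simp add: herm_part_of_skew)
  next
    fix u :: 'a assume "u \<in> positive_cone"
    then show "F (- u) \<le> 0"
      by (intro F(2) W[of _ 0]) (simp add: herm_part_of_selfadjoint star_of_positive)
  qed
  then obtain \<phi> where \<phi>: "\<phi> \<in> dual_pos" "\<And>x. Re (blinfun_apply \<phi> x) = F x" by blast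
  have "F a \<le> 0" by (intro F(2) W[of _ 1]) (simp add: herm_part_of_selfadjoint sa)
  moreover have "F (- a) \<le> 0" by (intro F(2) W[of _ "- 1"]) (simp add: herm_part_of_selfadjoint sa)
  ultimately have "F a = 0" using linear_neg[OF F(1), of a] by simp
  moreover have "F (- 1) \<le> - 1" by (intro F(2) W[of _ 0]) (simp add: herm_part_of_selfadjoint)
  then have "\<phi> \<noteq> 0" using \<phi>(2)[of "- 1"] by auto
  ultimately show ?thesis using \<phi> by metis
qed

text \<open>
  The positive part \<open>f1\<close> has to satisfy \<open>f1 \<ge> 0\<close>, \<open>f1 \<ge> f\<close> and \<open>f1 1 \<le> M\<close> with
  \<open>M = (norm f + f 1) / 2\<close>; then \<open>f2 = f1 - f\<close> is positive and \<open>f1 1 + f2 1 \<le> 2 M - f 1 = norm f\<close>.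
  These conditions amount to the demands \<open>f1 x \<le> t M - f v\<close> whenever \<open>t \<ge> 0\<close>, \<open>v \<ge> 0\<close> and
  \<open>x \<le> t \<sqdot> 1 - v\<close>. They are consistent: \<open>0 \<le> v \<le> t \<sqdot> 1\<close> says that \<open>v\<close> is within \<open>t / 2\<close> of
  \<open>t / 2 \<sqdot> 1\<close>, so \<open>f v \<le> t / 2 \<sqdot> (norm f + f 1) = t M\<close>.
\<close>

theorem positive_decomposition:
  fixes f :: "'a::cstar_algebra \<Rightarrow>\<^sub>L complex"
  assumes f: "f \<in> dual_herm"
  shows "\<exists>f1\<in>dual_pos. \<exists>f2\<in>dual_pos. f = f1 - f2 \<and>
    Re (blinfun_apply f1 1) + Re (blinfun_apply f2 1) \<le> norm f"
proof -
  define g where "g = (\<lambda>x. Re (blinfun_apply f x))"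
  have g: "g (x + y) = g x + g y" "g (c *\<^sub>R x) = c * g x" "g 0 = 0" "g (- x) = - g x" for x y c
    by (simp_all add: g_def blinfun.bilinear_simps)
  have g_le: "g x \<le> norm f * norm x" for x
    using complex_Re_le_cmod[of "blinfun_apply f x"] norm_blinfun[of f x] by (simp add: g_def)
  define M where "M = (norm f + g 1) / 2"
  have M: "0 \<le> M" using g_le[of "- 1"] by (simp add: M_def g)
  define W where "W = {(x, t * M - g v) | x t v.
      0 \<le> t \<and> v \<in> positive_cone \<and> of_real t - v - herm_part x \<in> positive_cone}"
  have W: "(x, r) \<in> W" if "0 \<le> t" "v \<in> positive_cone" "of_real t - v - herm_part x \<in> positive_cone"
    "r = t * M - g v" for x t v r
    using that by (auto simp: W_def)
  obtain F where F: "linear F" "\<And>x t. (x, t) \<in> W \<Longrightarrow> F x \<le> t"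
  proof (rule cone_imp_linear_minorant[of W])
    fix x y r s assume "(x, r) \<in> W" "(y, s) \<in> W"
    then obtain t v t' v' where *: "0 \<le> t" "v \<in> positive_cone" "0 \<le> t'" "v' \<in> positive_cone"
      and r: "r = t * M - g v" "s = t' * M - g v'"
      and p: "of_real t - v - herm_part x \<in> positive_cone" "of_real t' - v' - herm_part y \<in> positive_cone"
      by (auto simp: W_def)
    have "(of_real t - v - herm_part x) + (of_real t' - v' - herm_part y) \<in> positive_cone"
      by (rule positive_add[OF p])
    then show "(x + y, r + s) \<in> W"
      by (intro W[of "t + t'" "v + v'"])
        (use * r in \<open>simp_all add: herm_part_add positive_add g algebra_simps\<close>)
  next
    fix c r :: real and x assume c: "0 < c" and "(x, r) \<in> W"
    then obtain t v where *: "0 \<le> t" "v \<in> positive_cone"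
      and r: "r = t * M - g v" and p: "of_real t - v - herm_part x \<in> positive_cone"
      by (auto simp: W_def)
    have "c *\<^sub>R (of_real t - v - herm_part x) \<in> positive_cone"
      using c p by (intro positive_scaleR) auto
    then show "(c *\<^sub>R x, c * r) \<in> W"
      unfolding r by (intro W[of "c * t" "c *\<^sub>R v"])
        (use * c in \<open>simp_all add: herm_part_scaleR positive_scaleR g of_real_def algebra_simps\<close>)
  next
    fix x show "\<exists>r. (x, r) \<in> W"
      by (rule exI, rule W[of "norm (herm_part x)" 0]) (simp_all add: norm_minus_selfadjoint_positive)
  next
    fix r assume "(0, r) \<in> W"
    then obtain t v where *: "0 \<le> t" "v \<in> positive_cone" "of_real t - v \<in> positive_cone"
      and r: "r = t * M - g v"
      by (auto simp: W_def herm_part_def)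
    have half: "of_real t = (of_real (t / 2) + of_real (t / 2) :: 'a)" by (simp flip: of_real_add)
    have "norm (v - of_real (t / 2)) \<le> t / 2"
    proof (rule norm_le_of_positive)
      show "of_real (t / 2) - (v - of_real (t / 2)) \<in> positive_cone"
        using *(3) unfolding half by (simp add: algebra_simps)
      show "of_real (t / 2) + (v - of_real (t / 2)) \<in> positive_cone" using *(2) by simp
    qed
    then have "norm f * norm (v - of_real (t / 2)) \<le> norm f * (t / 2)" by (intro mult_left_mono) auto
    then have "g (v - of_real (t / 2)) \<le> norm f * (t / 2)"
      using g_le[of "v - of_real (t / 2)"] by simp
    moreover have "g v = g (v - of_real (t / 2)) + t / 2 * g 1"
      using g(1)[of "v - of_real (t / 2)" "of_real (t / 2)"] g(2)[of "t / 2" 1] by (simp add: of_real_def)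
    ultimately show "0 \<le> r" by (simp add: r M_def field_simps)
  qed (rule that)
  have "\<exists>\<phi>\<in>dual_pos. \<forall>x. Re (blinfun_apply \<phi> x) = F x"
  proof (rule positive_functional_of_real_part[OF F(1), of M])
    fix x :: 'a
    have "F x \<le> norm (herm_part x) * M"
      by (rule F(2), rule W[of "norm (herm_part x)" 0]) (simp_all add: norm_minus_selfadjoint_positive g)
    also have "\<dots> \<le> norm x * M" by (intro mult_right_mono norm_herm_part_le M)
    finally show "F x \<le> M * norm x" by (simp add: mult.commute)
  next
    fix x :: 'a assume "star x = - x"
    then show "F x \<le> 0" by (intro F(2) W[of 0 0]) (simp_all add: herm_part_of_skew g)
  next
    fix u :: 'a assume "u \<in> positive_cone"
    then show "F (- u) \<le> 0"
      by (intro F(2) W[of 0 0]) (simp_all add: herm_part_of_selfadjoint star_of_positive g)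
  qed
  then obtain \<phi> where \<phi>: "\<phi> \<in> dual_pos" "\<And>x. Re (blinfun_apply \<phi> x) = F x" by blast
  have ge: "g v \<le> F v" if v: "v \<in> positive_cone" for v
  proof -
    have "F (- v) \<le> - g v"
      by (intro F(2) W[of 0 v]) (use v in \<open>simp_all add: herm_part_of_selfadjoint star_of_positive\<close>)
    then show ?thesis by (simp add: linear_neg[OF F(1)])
  qed
  have "blinfun_apply (\<phi> - f) u \<in> \<real>\<^sub>\<ge>\<^sub>0" if u: "u \<in> positive_cone" for u
  proof -
    have "blinfun_apply f (star u) = cnj (blinfun_apply f u)" using f by (simp add: dual_herm_def)
    then have "Im (blinfun_apply f u) = 0" using star_of_positive[OF u] by (simp add: complex_eq_iff)
    moreover have "Im (blinfun_apply \<phi> u) = 0"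
      using \<phi>(1) u by (simp add: dual_pos_def complex_nonneg_Reals_iff)
    ultimately show ?thesis
      using ge[OF u] \<phi>(2)[of u] by (simp add: complex_nonneg_Reals_iff blinfun.diff_left g_def)
  qed
  then have "\<phi> - f \<in> dual_pos"
    using \<phi>(1) f by (simp add: dual_pos_def dual_herm_def dual_def blinfun.diff_left algebra_simps)
  moreover have "F 1 \<le> M"
    by (rule F(2), rule W[of 1 0]) (simp_all add: herm_part_of_selfadjoint g)
  then have "Re (blinfun_apply \<phi> 1) + Re (blinfun_apply (\<phi> - f) 1) \<le> norm f"
    using \<phi>(2)[of 1] by (simp add: blinfun.diff_left M_def g_def)
  ultimately show ?thesis using \<phi>(1) by (intro bexI[of _ \<phi>] bexI[of _ "\<phi> - f"]) auto
qed

lemma dual_pos_nonneg: "f \<in> dual_pos \<Longrightarrow> x \<in> positive_cone \<Longrightarrow> 0 \<le> Re (blinfun_apply f x)"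
  by (simp add: dual_pos_def complex_nonneg_Reals_iff)

lemma dual_pos_of_real: "Re (blinfun_apply f (of_real t)) = t * Re (blinfun_apply f 1)"
  by (simp add: of_real_def blinfun.scaleR_right)

lemma dual_pos_selfadjoint:
  fixes x :: "'a::cstar_algebra"
  assumes f: "f \<in> dual_pos" and sa: "star x = x"
  shows "Im (blinfun_apply f x) = 0"
    and "Re (blinfun_apply f x) \<le> Re (blinfun_apply f 1) * norm x"
proof -
  have pos: "of_real (norm x) - x \<in> positive_cone" "of_real (norm x) \<in> (positive_cone :: 'a set)"
    using sa by (simp_all add: norm_minus_selfadjoint_positive positive_of_real)
  then have "Im (blinfun_apply f (of_real (norm x) - x)) = 0" "Im (blinfun_apply f (of_real (norm x))) = 0"
    using f by (auto simp: dual_pos_def complex_nonneg_Reals_iff)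
  then show "Im (blinfun_apply f x) = 0" by (simp add: blinfun.diff_right)
  show "Re (blinfun_apply f x) \<le> Re (blinfun_apply f 1) * norm x"
    using dual_pos_nonneg[OF f pos(1)] by (simp add: blinfun.diff_right dual_pos_of_real mult.commute)
qed

lemma dual_pos_skew:
  assumes f: "f \<in> dual_pos" and skew: "star x = - x"
  shows "Re (blinfun_apply f x) = 0"
proof -
  have "star (\<i> *\<^sub>C x) = \<i> *\<^sub>C x" using skew by (simp add: star_scaleC)
  then have "Im (blinfun_apply f (\<i> *\<^sub>C x)) = 0" by (rule dual_pos_selfadjoint(1)[OF f])
  moreover have "blinfun_apply f (\<i> *\<^sub>C x) = \<i> * blinfun_apply f x"
    using f by (simp add: dual_pos_def dual_def)
  ultimately show ?thesis by simp
qed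

lemma dual_pos_subset_dual_herm: "dual_pos \<subseteq> dual_herm"
proof
  fix f :: "'a \<Rightarrow>\<^sub>L complex" assume f: "f \<in> dual_pos"
  have "blinfun_apply f (star x) = cnj (blinfun_apply f x)" for x
  proof -
    have "Re (blinfun_apply f (x - star x)) = 0"
      by (rule dual_pos_skew[OF f]) (simp add: star_diff star_star)
    moreover have "Im (blinfun_apply f (x + star x)) = 0"
      by (rule dual_pos_selfadjoint(1)[OF f]) (simp add: star_add star_star add.commute)
    ultimately show ?thesis by (simp add: blinfun.bilinear_simps complex_eq_iff)
  qed
  then show "f \<in> dual_herm" using f by (simp add: dual_herm_def dual_pos_def)
qed

text \<open>
  After rotating \<open>x\<close> so that \<open>f x\<close> is its modulus, only the Hermitian part of \<open>x\<close> contributes, and there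
  \<open>x \<le> norm x \<sqdot> 1\<close> gives \<open>f x \<le> norm x \<sqdot> f 1\<close>.
\<close>

theorem norm_dual_pos_le:
  assumes f: "f \<in> dual_pos"
  shows "norm f \<le> Re (blinfun_apply f 1)"
proof (rule norm_blinfun_bound)
  show "0 \<le> Re (blinfun_apply f 1)"
    using dual_pos_nonneg[OF f positive_of_real[of 1]] by simp
  fix x
  define c where "c = cis (- Arg (blinfun_apply f x))"
  have "c * blinfun_apply f x = of_real (cmod (blinfun_apply f x))"
    unfolding c_def by (subst (2) rcis_cmod_Arg[symmetric]) (simp add: rcis_def cis_mult)
  then have "cmod (blinfun_apply f x) = Re (blinfun_apply f (c *\<^sub>C x))"
    using f by (simp add: dual_pos_def dual_def)
  also have "\<dots> = Re (blinfun_apply f (herm_part (c *\<^sub>C x)))"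
  proof -
    have "Re (blinfun_apply f (c *\<^sub>C x - star (c *\<^sub>C x))) = 0"
      by (rule dual_pos_skew[OF f]) (simp add: star_diff star_star)
    then show ?thesis by (simp add: herm_part_def blinfun.bilinear_simps)
  qed
  also have "\<dots> \<le> Re (blinfun_apply f 1) * norm (herm_part (c *\<^sub>C x))"
    by (rule dual_pos_selfadjoint(2)[OF f]) simp
  also have "\<dots> \<le> Re (blinfun_apply f 1) * norm (c *\<^sub>C x)"
    by (intro mult_left_mono norm_herm_part_le \<open>0 \<le> Re (blinfun_apply f 1)\<close>)
  also have "norm (c *\<^sub>C x) = norm x" by (simp add: norm_scaleC c_def)
  finally show "norm (blinfun_apply f x) \<le> Re (blinfun_apply f 1) * norm x" .
qed

section \<open>The seminorms and the dual norm\<close>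

lemma dual_pos_add: "f \<in> dual_pos \<Longrightarrow> g \<in> dual_pos \<Longrightarrow> f + g \<in> dual_pos"
  by (auto simp: dual_pos_def dual_def blinfun.add_left algebra_simps nonneg_Reals_add_I)

lemma dual_pos_scaleR: "0 \<le> c \<Longrightarrow> f \<in> dual_pos \<Longrightarrow> c *\<^sub>R f \<in> dual_pos"
  by (auto simp: dual_pos_def dual_def blinfun.scaleR_left complex_nonneg_Reals_iff)

lemma dual_herm_scaleR: "f \<in> dual_herm \<Longrightarrow> c *\<^sub>R f \<in> dual_herm"
  by (auto simp: dual_herm_def dual_def blinfun.scaleR_left)

context
  fixes b :: "'a::cstar_algebra"
  assumes b: "b \<in> positive_cone"
begin

lemma r_seminorm_le:
  assumes "f1 \<in> dual_pos" "f2 \<in> dual_pos"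
  shows "r_seminorm b (f1 - f2) \<le> Re (blinfun_apply f1 b) + Re (blinfun_apply f2 b)"
  unfolding r_seminorm_def
  by (rule cInf_lower)
    (use assms b in \<open>auto intro!: bdd_belowI[of _ 0] add_nonneg_nonneg dual_pos_nonneg\<close>)

lemma r_seminorm_ge:
  assumes f: "f \<in> dual_herm"
    and le: "\<And>f1 f2. f1 \<in> dual_pos \<Longrightarrow> f2 \<in> dual_pos \<Longrightarrow> f = f1 - f2 \<Longrightarrow>
      m \<le> Re (blinfun_apply f1 b) + Re (blinfun_apply f2 b)"
  shows "m \<le> r_seminorm b f"
  unfolding r_seminorm_def
  by (rule cInf_greatest) (use positive_decomposition[OF f] le in auto)

lemma r_seminorm_triangle:
  assumes f: "f \<in> dual_herm" and g: "g \<in> dual_herm"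
  shows "r_seminorm b (f + g) \<le> r_seminorm b f + r_seminorm b g"
proof -
  have "r_seminorm b (f + g) - r_seminorm b g \<le> Re (blinfun_apply f1 b) + Re (blinfun_apply f2 b)"
    if f12: "f1 \<in> dual_pos" "f2 \<in> dual_pos" "f = f1 - f2" for f1 f2
  proof -
    have "r_seminorm b (f + g) - (Re (blinfun_apply f1 b) + Re (blinfun_apply f2 b)) \<le> r_seminorm b g"
    proof (rule r_seminorm_ge[OF g])
      fix g1 g2 assume g12: "g1 \<in> dual_pos" "g2 \<in> dual_pos" "g = g1 - g2"
      have "f + g = (f1 + g1) - (f2 + g2)" using f12 g12 by simp
      then show "r_seminorm b (f + g) - (Re (blinfun_apply f1 b) + Re (blinfun_apply f2 b))
          \<le> Re (blinfun_apply g1 b) + Re (blinfun_apply g2 b)"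
        using r_seminorm_le[OF dual_pos_add[OF f12(1) g12(1)] dual_pos_add[OF f12(2) g12(2)]]
        by (simp add: blinfun.add_left)
    qed
    then show ?thesis by linarith
  qed
  then have "r_seminorm b (f + g) - r_seminorm b g \<le> r_seminorm b f" by (rule r_seminorm_ge[OF f])
  then show ?thesis by linarith
qed

lemma r_seminorm_scaleR_le:
  assumes f: "f \<in> dual_herm" and c: "c \<noteq> 0"
  shows "r_seminorm b (c *\<^sub>R f) \<le> \<bar>c\<bar> * r_seminorm b f"
proof -
  have "r_seminorm b (c *\<^sub>R f) / \<bar>c\<bar> \<le> Re (blinfun_apply f1 b) + Re (blinfun_apply f2 b)"
    if f12: "f1 \<in> dual_pos" "f2 \<in> dual_pos" "f = f1 - f2" for f1 f2
  proof (cases "0 < c")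
    case True
    have "c *\<^sub>R f = c *\<^sub>R f1 - c *\<^sub>R f2" using f12(3) by (simp add: scaleR_diff_right)
    then have "r_seminorm b (c *\<^sub>R f) \<le> c * (Re (blinfun_apply f1 b) + Re (blinfun_apply f2 b))"
      using r_seminorm_le[OF dual_pos_scaleR[OF _ f12(1)] dual_pos_scaleR[OF _ f12(2)], of c c] True
      by (simp add: blinfun.scaleR_left distrib_left)
    then show ?thesis using True by (simp add: divide_le_eq mult.commute)
  next
    case False
    define d where "d = - c"
    have d: "0 < d" "\<bar>c\<bar> = d" using False c by (simp_all add: d_def)
    have "c *\<^sub>R f = d *\<^sub>R f2 - d *\<^sub>R f1"
      using f12(3) by (simp add: d_def scaleR_diff_right)
    then have "r_seminorm b (c *\<^sub>R f) \<le> d * (Re (blinfun_apply f1 b) + Re (blinfun_apply f2 b))"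
      using r_seminorm_le[OF dual_pos_scaleR[OF _ f12(2)] dual_pos_scaleR[OF _ f12(1)], of d d] d(1)
      by (simp add: blinfun.scaleR_left distrib_left)
    then show ?thesis using d by (simp add: divide_le_eq mult.commute)
  qed
  then have "r_seminorm b (c *\<^sub>R f) / \<bar>c\<bar> \<le> r_seminorm b f" by (rule r_seminorm_ge[OF f])
  then show ?thesis using c by (simp add: divide_le_eq mult.commute)
qed

lemma r_seminorm_scaleR:
  assumes f: "f \<in> dual_herm" and c: "c \<noteq> 0"
  shows "r_seminorm b (c *\<^sub>R f) = \<bar>c\<bar> * r_seminorm b f"
proof (rule antisym[OF r_seminorm_scaleR_le[OF f c]])
  have "r_seminorm b (inverse c *\<^sub>R (c *\<^sub>R f)) \<le> \<bar>inverse c\<bar> * r_seminorm b (c *\<^sub>R f)"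
    by (rule r_seminorm_scaleR_le[OF dual_herm_scaleR[OF f]]) (simp add: c)
  then have "r_seminorm b f \<le> r_seminorm b (c *\<^sub>R f) / \<bar>c\<bar>" using c by (simp add: divide_inverse mult.commute)
  then show "\<bar>c\<bar> * r_seminorm b f \<le> r_seminorm b (c *\<^sub>R f)" using c by (simp add: le_divide_eq mult.commute)
qed

end

text \<open>
  The lower bound uses \<open>norm f \<le> norm f1 + norm f2 \<le> f1 1 + f2 1\<close> for every decomposition, the upper
  bound the decomposition of \<open>positive_decomposition\<close>.
\<close>

lemma r_seminorm_bounds:
  fixes b :: "'a::cstar_algebra"
  assumes "0 \<le> c" and lower: "b - of_real c \<in> positive_cone" and upper: "of_real d - b \<in> positive_cone"
    and f: "f \<in> dual_herm"
  shows "c * norm f \<le> r_seminorm b f" "r_seminorm b f \<le> d * norm f"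
proof -
  have b: "b \<in> positive_cone"
    using positive_add[OF lower positive_of_real[OF \<open>0 \<le> c\<close>]] by simp
  have lo: "c * Re (blinfun_apply g 1) \<le> Re (blinfun_apply g b)"
    and up: "Re (blinfun_apply g b) \<le> d * Re (blinfun_apply g 1)" if "g \<in> dual_pos" for g
    using dual_pos_nonneg[OF that lower] dual_pos_nonneg[OF that upper]
    by (simp_all add: blinfun.diff_right dual_pos_of_real)
  show "c * norm f \<le> r_seminorm b f"
  proof (rule r_seminorm_ge[OF b f])
    fix f1 f2 assume f12: "f1 \<in> dual_pos" "f2 \<in> dual_pos" "f = f1 - f2"
    have "norm f \<le> norm f1 + norm f2" unfolding f12(3) by (rule norm_triangle_ineq4)
    also have "\<dots> \<le> Re (blinfun_apply f1 1) + Re (blinfun_apply f2 1)"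
      by (intro add_mono norm_dual_pos_le f12)
    finally have "c * norm f \<le> c * (Re (blinfun_apply f1 1) + Re (blinfun_apply f2 1))"
      using \<open>0 \<le> c\<close> by (rule mult_left_mono)
    then show "c * norm f \<le> Re (blinfun_apply f1 b) + Re (blinfun_apply f2 b)"
      using lo[OF f12(1)] lo[OF f12(2)] by (simp add: distrib_left)
  qed
  have "of_real (d - c) \<in> (positive_cone :: 'a set)" using positive_add[OF lower upper] by simp
  then have "0 \<le> d - c"
    using nonneg_of_positive_of_real[of "d - c" "0::'a"] by (simp add: mem_spectrum_iff)
  then have "0 \<le> d" using \<open>0 \<le> c\<close> by simp
  obtain f1 f2 where f12: "f1 \<in> dual_pos" "f2 \<in> dual_pos" "f = f1 - f2"
    and le: "Re (blinfun_apply f1 1) + Re (blinfun_apply f2 1) \<le> norm f"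
    using positive_decomposition[OF f] by blast
  have "r_seminorm b f \<le> d * (Re (blinfun_apply f1 1) + Re (blinfun_apply f2 1))"
    using r_seminorm_le[OF b f12(1,2)] up[OF f12(1)] up[OF f12(2)] f12(3) by (simp add: distrib_left)
  also have "\<dots> \<le> d * norm f" by (rule mult_left_mono[OF le \<open>0 \<le> d\<close>])
  finally show "r_seminorm b f \<le> d * norm f" .
qed

theorem r_seminorm_equivalent_norm:
  fixes b :: "'a::cstar_algebra"
  assumes c: "0 < c" and lower: "b - of_real c \<in> positive_cone" and upper: "of_real d - b \<in> positive_cone"
  shows "equivalent_norms_on dual_herm (r_seminorm b) norm"
proof -
  have b: "b \<in> positive_cone"
    using positive_add[OF lower positive_of_real[of c]] c by simp
  note bounds = r_seminorm_bounds[OF less_imp_le[OF c] lower upper]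
  define e where "e = max d 1"
  have e: "0 < e" by (simp add: e_def)
  have le: "r_seminorm b f \<le> e * norm f" if "f \<in> dual_herm" for f
    using bounds(2)[OF that] mult_right_mono[of d e "norm f"] by (simp add: e_def)
  have "norm_on dual_herm (r_seminorm b)"
    unfolding norm_on_def
  proof (intro conjI ballI allI)
    fix f :: "'a \<Rightarrow>\<^sub>L complex" assume f: "f \<in> dual_herm"
    have "0 \<le> c * norm f" using c by simp
    then show "0 \<le> r_seminorm b f" using bounds(1)[OF f] by simp
    show "r_seminorm b f = 0 \<longleftrightarrow> f = 0"
    proof
      assume "r_seminorm b f = 0"
      then have "c * norm f \<le> 0" using bounds(1)[OF f] by simp
      then show "f = 0" using c by (simp add: mult_le_0_iff)
    next
      assume "f = 0"
      then show "r_seminorm b f = 0" using bounds[OF f] by simp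
    qed
    show "r_seminorm b (r *\<^sub>R f) = \<bar>r\<bar> * r_seminorm b f" for r
    proof (cases "r = 0")
      case True
      then show ?thesis using bounds[OF dual_herm_scaleR[OF f, of 0]] by simp
    next
      case False
      then show ?thesis by (rule r_seminorm_scaleR[OF b f])
    qed
  qed (rule r_seminorm_triangle[OF b])
  moreover have "norm_on dual_herm norm" by (auto simp: norm_on_def norm_triangle_ineq)
  moreover have "1 / e * r_seminorm b f \<le> norm f \<and> norm f \<le> 1 / c * r_seminorm b f"
    if "f \<in> dual_herm" for f
    using le[OF that] bounds(1)[OF that] c e by (simp add: field_simps)
  then have "\<exists>m>0. \<exists>M>0. \<forall>f\<in>dual_herm. m * r_seminorm b f \<le> norm f \<and> norm f \<le> M * r_seminorm b f"
    using c e by (intro exI[of _ "1 / e"] conjI exI[of _ "1 / c"]) auto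
  ultimately show ?thesis by (simp add: equivalent_norms_on_def)
qed

lemma equivalent_norms_on_common:
  assumes p: "equivalent_norms_on S p n" and q: "equivalent_norms_on S q n"
  shows "equivalent_norms_on S p q"
proof -
  obtain c C where c: "0 < c" "0 < C" "\<And>x. x \<in> S \<Longrightarrow> c * p x \<le> n x \<and> n x \<le> C * p x"
    using p unfolding equivalent_norms_on_def by blast
  obtain d D where d: "0 < d" "0 < D" "\<And>x. x \<in> S \<Longrightarrow> d * q x \<le> n x \<and> n x \<le> D * q x"
    using q unfolding equivalent_norms_on_def by blast
  have "c / D * p x \<le> q x \<and> q x \<le> C / d * p x" if "x \<in> S" for x
    using order_trans[of "c * p x" "n x" "D * q x"] order_trans[of "d * q x" "n x" "C * p x"]
      c d that by (simp add: field_simps)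
  then have "\<exists>m>0. \<exists>M>0. \<forall>x\<in>S. m * p x \<le> q x \<and> q x \<le> M * p x"
    using c d by (intro exI[of _ "c / D"] conjI exI[of _ "C / d"]) auto
  then show ?thesis using p q by (simp add: equivalent_norms_on_def)
qed

section \<open>Characterisations of invertibility\<close>

lemma cstar_power_equivalent_norm:
  "a \<in> positive_cone \<Longrightarrow> invertible_elem a \<Longrightarrow>
    equivalent_norms_on dual_herm (r_seminorm (cstar_power a \<alpha>)) norm"
  using cstar_power_bounds[of a \<alpha>] r_seminorm_equivalent_norm by blast

lemma positive_on_functionals_of_invertible:
  assumes pos: "a \<in> positive_cone" and inv: "invertible_elem a" and \<phi>: "\<phi> \<in> dual_pos - {0}"
  shows "0 < Re (blinfun_apply \<phi> a)"
proof -
  obtain c where c: "0 < c" "a - of_real c \<in> positive_cone"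
    using cstar_power_bounds[OF pos inv, of 1] by (auto simp: cstar_power_one[OF pos])
  have "0 < norm \<phi>" using \<phi> by simp
  also have "norm \<phi> \<le> Re (blinfun_apply \<phi> 1)" using \<phi> by (intro norm_dual_pos_le) blast
  finally have "0 < Re (blinfun_apply \<phi> 1)" .
  then have "0 < c * Re (blinfun_apply \<phi> 1)" using c by simp
  also have "\<dots> \<le> Re (blinfun_apply \<phi> a)"
    using dual_pos_nonneg[of \<phi> "a - of_real c"] \<phi> c by (simp add: blinfun.diff_right dual_pos_of_real)
  finally show ?thesis .
qed

text \<open>
  The contrapositive of \<open>ex_positive_functional_vanishing\<close>.
\<close>

lemma invertible_of_positive_on_functionals:
  assumes pos: "a \<in> positive_cone" and gt: "\<forall>\<phi>\<in>dual_pos - {0}. 0 < Re (blinfun_apply \<phi> a)"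
  shows "invertible_elem a"
proof (rule ccontr)
  assume "\<not> invertible_elem a"
  then have "0 \<in> spectrum a" by (simp add: mem_spectrum_iff)
  then obtain \<phi> where "\<phi> \<in> dual_pos" "\<phi> \<noteq> 0" "Re (blinfun_apply \<phi> a) = 0"
    using ex_positive_functional_vanishing[OF star_of_positive[OF pos]] by blast
  then show False using bspec[OF gt, of \<phi>] by simp
qed

text \<open>
  The decomposition \<open>\<phi> = \<phi> - 0\<close> bounds the seminorm of \<open>\<phi>\<close> by \<open>\<phi> a\<close>.
\<close>

lemma positive_on_functionals_of_norm:
  assumes pos: "a \<in> positive_cone" and norm: "norm_on dual_herm (r_seminorm a)"
    and \<phi>: "\<phi> \<in> dual_pos - {0}"
  shows "0 < Re (blinfun_apply \<phi> a)"
proof -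
  have herm: "\<phi> \<in> dual_herm" using \<phi> dual_pos_subset_dual_herm by blast
  have "0 \<in> dual_pos" by (simp add: dual_pos_def dual_def)
  then have "r_seminorm a \<phi> \<le> Re (blinfun_apply \<phi> a)"
    using r_seminorm_le[OF pos, of \<phi> 0] \<phi> by simp
  moreover have "0 \<le> r_seminorm a \<phi> \<and> r_seminorm a \<phi> \<noteq> 0"
    using norm herm \<phi> by (auto simp: norm_on_def)
  ultimately show ?thesis by simp
qed

theorem theorem4:
  fixes a :: "'a::cstar_algebra"
  assumes "a \<in> positive_cone"
  shows
    "(invertible_elem a \<longleftrightarrow>
        (\<forall>\<alpha>::real. power_defined a \<alpha> \<and>
           equivalent_norms_on dual_herm (r_seminorm (cstar_power a \<alpha>)) norm))
     \<and>
     (invertible_elem a \<longleftrightarrow>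
        (\<forall>\<alpha>::real. \<alpha> > 0 \<longrightarrow>
           equivalent_norms_on dual_herm (r_seminorm (cstar_power a \<alpha>)) norm))
     \<and>
     (invertible_elem a \<longleftrightarrow>
        (\<forall>\<phi>\<in>dual_pos - {0}. 0 < Re (blinfun_apply \<phi> a)) \<and>
        (\<exists>\<alpha> \<beta> :: real. \<alpha> > 0 \<and> \<beta> > 0 \<and> \<alpha> \<noteq> \<beta> \<and>
           equivalent_norms_on dual_herm
             (r_seminorm (cstar_power a \<alpha>)) (r_seminorm (cstar_power a \<beta>))))"
    (is "(?I \<longleftrightarrow> (\<forall>\<alpha>. ?ii \<alpha>)) \<and> (?I \<longleftrightarrow> (\<forall>\<alpha>. \<alpha> > 0 \<longrightarrow> ?iii \<alpha>)) \<and> (?I \<longleftrightarrow> ?p \<and> ?iv)")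
proof -
  have equiv: "?iii \<alpha>" if ?I for \<alpha>
    by (rule cstar_power_equivalent_norm[OF assms that])
  have ii: "?I \<longleftrightarrow> (\<forall>\<alpha>. ?ii \<alpha>)"
  proof
    assume ?I then show "\<forall>\<alpha>. ?ii \<alpha>" using equiv by (simp add: power_defined_def)
  next
    assume "\<forall>\<alpha>. ?ii \<alpha>"
    then have "power_defined a (- 1)" by blast
    then show ?I by (simp add: power_defined_def)
  qed
  have iii: "?I \<longleftrightarrow> (\<forall>\<alpha>. \<alpha> > 0 \<longrightarrow> ?iii \<alpha>)"
  proof
    assume ?I then show "\<forall>\<alpha>. \<alpha> > 0 \<longrightarrow> ?iii \<alpha>" using equiv by blast
  next
    assume "\<forall>\<alpha>. \<alpha> > 0 \<longrightarrow> ?iii \<alpha>"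
    then have "?iii 1" by simp
    then have "norm_on dual_herm (r_seminorm a)"
      by (simp add: equivalent_norms_on_def cstar_power_one[OF assms])
    then show ?I
      using invertible_of_positive_on_functionals[OF assms] positive_on_functionals_of_norm[OF assms]
      by blast
  qed
  have iv: "?I \<longleftrightarrow> ?p \<and> ?iv"
  proof
    assume I: ?I
    have "equivalent_norms_on dual_herm (r_seminorm (cstar_power a 1)) (r_seminorm (cstar_power a 2))"
      by (rule equivalent_norms_on_common[OF equiv[OF I] equiv[OF I]])
    then have ?iv by (intro exI[of _ 1] exI[of _ 2]) simp
    then show "?p \<and> ?iv" using positive_on_functionals_of_invertible[OF assms I] by blast
  next
    assume "?p \<and> ?iv"
    then show ?I using invertible_of_positive_on_functionals[OF assms] by blast
  qed
  show ?thesis using ii iii iv by blast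
qed

end
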